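(* Let $\mathbb{H}$ be a complex separable Hilbert space, let $\{P_n\}$ be a sequence of orthogonal projections on $\mathbb{H}$ with $\operatorname{rank}(P_n)=n$ and $P_n x\to x$ for every $x\in\mathbb{H}$, and let $\{\Phi_n\}$ be a sequence of completely positive linear maps $\Phi_n:\mathbb{B}(\mathbb{H})\to\mathbb{B}(\mathbb{H})$ with $\|\Phi_n\|\le 1$. Let $\{A_1,\dots,A_m\}$ be a finite set of self-adjoint operators in $\mathbb{B}(\mathbb{H})$ such that $\Phi_n(A)$ converges to $A$ in the strong (respectively weak) distribution sense for every $A\in\{A_1,\dots,A_m,A_1^2,\dots,A_m^2\}$. Assume in addition that, for each $k=1,\dots,m$, the sequence $P_nA_k^2P_n-(P_nA_kP_n)^2$ converges to the zero matrix in strong cluster (respectively weak cluster). Then $\Phi_n(A)$ converges to $A$ in the strong (respectively weak) distribution sense for every $A$ in the $C^*$-algebra generated by $\{A_1,\dots,A_m\}$.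
   Context: $\mathbb{B}(\mathbb{H})$ is the algebra of bounded linear operators on $\mathbb{H}$. For $T\in\mathbb{B}(\mathbb{H})$, $P_nTP_n$ is regarded as an $n\times n$ matrix by restricting to the range of $P_n$. Clusters: let $\{X_n\},\{Y_n\}$ be sequences of $n\times n$ matrices. $X_n$ converges to $Y_n$ in strong cluster if for every $\epsilon>0$ there exist integers $N_{1,\epsilon},N_{2,\epsilon}$ such that, for all $n>N_{2,\epsilon}$, all singular values of $X_n-Y_n$ lie in $[0,\epsilon)$ except for at most $N_{1,\epsilon}$ of them (counted with multiplicity), with $N_{1,\epsilon}$ independent of $n$. It converges in weak cluster if the same holds with $N_{1,\epsilon}$ allowed to depend on $n$ with $N_{1,\epsilon}=o(n)$ as $n\to\infty$ for each fixed $\epsilon$. Distribution sense: $\Phi_n(A)$ converges to $A$ in the strong (respectively weak) distribution sense if the matrices $P_n\Phi_n(A)P_n$ converge to $P_nAP_n$ in strong (respectively weak) cluster. *)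

theory Defs
  imports "HOL-Analysis.Analysis" "Jordan_Normal_Form.Schur_Decomposition"
begin

section \<open>Complex Hilbert spaces\<close>

text \<open>
  The inner product is linear in the first argument. The real vector space structure of \<^class>\<open>banach\<close>
  is the restriction of the complex one, and its norm is the one induced by the inner product.
\<close>

class complex_hilbert_space = banach +
  fixes scaleC :: "complex \<Rightarrow> 'a \<Rightarrow> 'a" (infixr \<open>*\<^sub>C\<close> 75)
    and cinner :: "'a \<Rightarrow> 'a \<Rightarrow> complex"
  assumes scaleC_add_right: "c *\<^sub>C (x + y) = c *\<^sub>C x + c *\<^sub>C y"
    and scaleC_add_left: "(c + d) *\<^sub>C x = c *\<^sub>C x + d *\<^sub>C x"
    and scaleC_scaleC: "c *\<^sub>C d *\<^sub>C x = (c * d) *\<^sub>C x"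
    and scaleC_of_real: "complex_of_real r *\<^sub>C x = r *\<^sub>R x"
    and cinner_commute: "cinner x y = cnj (cinner y x)"
    and cinner_add_left: "cinner (x + y) z = cinner x z + cinner y z"
    and cinner_scaleC_left: "cinner (c *\<^sub>C x) y = c * cinner x y"
    and cinner_ge_zero: "0 \<le> Re (cinner x x)"
    and norm_eq_sqrt_cinner: "norm x = sqrt (Re (cinner x x))"

global_interpretation complex_vector:
  vector_space "scaleC :: complex \<Rightarrow> 'a::complex_hilbert_space \<Rightarrow> 'a"
  by unfold_locales
    (simp_all add: scaleC_add_right scaleC_add_left scaleC_scaleC
      scaleC_of_real[of 1, simplified])

lemma cinner_scaleC_right: "cinner x (c *\<^sub>C y) = cnj c * cinner x y"
  by (metis cinner_commute cinner_scaleC_left complex_cnj_mult)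

lemma norm_scaleC: "norm (c *\<^sub>C x) = cmod c * norm x"
proof -
  have "cinner (c *\<^sub>C x) (c *\<^sub>C x) = complex_of_real ((cmod c)\<^sup>2) * cinner x x"
    by (simp add: cinner_scaleC_left cinner_scaleC_right complex_norm_square ac_simps del: of_real_power)
  then have "Re (cinner (c *\<^sub>C x) (c *\<^sub>C x)) = (cmod c)\<^sup>2 * Re (cinner x x)"
    by simp
  then show ?thesis
    by (simp add: norm_eq_sqrt_cinner real_sqrt_mult)
qed

definition is_onb :: "nat \<Rightarrow> (nat \<Rightarrow> 'a::complex_hilbert_space) \<Rightarrow> 'a set \<Rightarrow> bool" where
  "is_onb n e V \<longleftrightarrow>
     (\<forall>i<n. \<forall>j<n. cinner (e i) (e j) = (if i = j then 1 else 0)) \<and>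
     complex_vector.span (e ` {..<n}) = V"

section \<open>Bounded operators\<close>

text \<open>
  A complex-linear operator is bounded iff it is bounded as a real-linear one, with the same operator
  norm. So the algebra of bounded operators is a norm-closed subset of the space of
  real-linear bounded maps.
\<close>

type_synonym 'a operator = "'a \<Rightarrow>\<^sub>L 'a"

definition bounded_ops :: "'a::complex_hilbert_space operator set" where
  "bounded_ops = {T :: 'a operator. \<forall>c x. T (c *\<^sub>C x) = c *\<^sub>C T x}"

lift_definition scaleC_op :: "complex \<Rightarrow> 'a::complex_hilbert_space operator \<Rightarrow> 'a operator"
  is "\<lambda>c T x. c *\<^sub>C T x"
proof -
  fix c :: complex and T :: "'a \<Rightarrow> 'a"
  assume T: "bounded_linear T"
  have "bounded_linear (\<lambda>x::'a. c *\<^sub>C x)"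
  proof (rule bounded_linear_intro)
    show "c *\<^sub>C (r *\<^sub>R x) = r *\<^sub>R (c *\<^sub>C x)" for r and x :: 'a
      by (simp add: scaleC_scaleC mult.commute flip: scaleC_of_real)
    show "norm (c *\<^sub>C x) \<le> norm x * cmod c" for x :: 'a
      by (simp add: norm_scaleC mult.commute)
  qed (rule scaleC_add_right)
  then show "bounded_linear (\<lambda>x. c *\<^sub>C T x)"
    using T by (rule bounded_linear_compose)
qed

text \<open>The adjoint as a relation: \<open>S\<close> is the adjoint of \<open>T\<close>.\<close>

definition is_adjoint :: "'a::complex_hilbert_space operator \<Rightarrow> 'a operator \<Rightarrow> bool" where
  "is_adjoint T S \<longleftrightarrow>
     T \<in> bounded_ops \<and> S \<in> bounded_ops \<and> (\<forall>x y. cinner (T x) y = cinner x (S y))"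

definition self_adjoint :: "'a::complex_hilbert_space operator \<Rightarrow> bool" where
  "self_adjoint T \<longleftrightarrow> is_adjoint T T"

definition orthogonal_projection :: "'a::complex_hilbert_space operator \<Rightarrow> bool" where
  "orthogonal_projection P \<longleftrightarrow> self_adjoint P \<and> P o\<^sub>L P = P"

text \<open>Infinite rank is mapped to \<open>0\<close>; positive values are genuine ranks.\<close>

definition op_rank :: "'a::complex_hilbert_space operator \<Rightarrow> nat" where
  "op_rank T = complex_vector.dim (range (blinfun_apply T))"

text \<open>The unit is not required to belong to a \<open>C\<^sup>*\<close>-subalgebra.\<close>

definition cstar_subalgebra :: "'a::complex_hilbert_space operator set \<Rightarrow> bool" where
  "cstar_subalgebra B \<longleftrightarrow>
     B \<subseteq> bounded_ops \<and> 0 \<in> B \<and>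
     (\<forall>S\<in>B. \<forall>T\<in>B. S + T \<in> B) \<and>
     (\<forall>c. \<forall>T\<in>B. scaleC_op c T \<in> B) \<and>
     (\<forall>S\<in>B. \<forall>T\<in>B. S o\<^sub>L T \<in> B) \<and>
     (\<forall>T\<in>B. \<forall>S. is_adjoint T S \<longrightarrow> S \<in> B) \<and>
     closed B"

definition cstar_generated :: "'a::complex_hilbert_space operator set \<Rightarrow> 'a operator set" where
  "cstar_generated G = \<Inter> {B. cstar_subalgebra B \<and> G \<subseteq> B}"

section \<open>Completely positive maps\<close>

text \<open>
  Maps on the algebra of bounded operators are functions on the type \<^typ>\<open>'a operator\<close>; only their
  values on \<^const>\<open>bounded_ops\<close> matter.
\<close>

definition linear_op_map :: "('a::complex_hilbert_space operator \<Rightarrow> 'a operator) \<Rightarrow> bool" where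
  "linear_op_map \<Phi> \<longleftrightarrow>
     (\<forall>T\<in>bounded_ops. \<Phi> T \<in> bounded_ops) \<and>
     (\<forall>S\<in>bounded_ops. \<forall>T\<in>bounded_ops. \<Phi> (S + T) = \<Phi> S + \<Phi> T) \<and>
     (\<forall>c. \<forall>T\<in>bounded_ops. \<Phi> (scaleC_op c T) = scaleC_op c (\<Phi> T))"

text \<open>
  A \<open>k\<close> by \<open>k\<close> matrix of operators is positive if it is positive as an operator on the
  \<open>k\<close>-fold direct sum of the Hilbert space. The order on \<^typ>\<open>complex\<close> is the one in which
  \<open>0 \<le> z\<close> means that \<open>z\<close> is real and nonnegative.
\<close>

definition positive_op_matrix ::
    "nat \<Rightarrow> (nat \<Rightarrow> nat \<Rightarrow> 'a::complex_hilbert_space operator) \<Rightarrow> bool" where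
  "positive_op_matrix k T \<longleftrightarrow>
     (\<forall>x :: nat \<Rightarrow> 'a. 0 \<le> (\<Sum>i<k. \<Sum>j<k. cinner (T i j (x j)) (x i)))"

definition completely_positive ::
    "('a::complex_hilbert_space operator \<Rightarrow> 'a operator) \<Rightarrow> bool" where
  "completely_positive \<Phi> \<longleftrightarrow> linear_op_map \<Phi> \<and>
     (\<forall>k T. (\<forall>i<k. \<forall>j<k. T i j \<in> bounded_ops) \<and> positive_op_matrix k T \<longrightarrow>
        positive_op_matrix k (\<lambda>i j. \<Phi> (T i j)))"

definition contractive :: "('a::complex_hilbert_space operator \<Rightarrow> 'a operator) \<Rightarrow> bool" where
  "contractive \<Phi> \<longleftrightarrow> (\<forall>T\<in>bounded_ops. norm (\<Phi> T) \<le> norm T)"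

section \<open>Clusters of matrix sequences\<close>

text \<open>
  Singular values with multiplicity: square roots of the eigenvalues of \<open>X\<^sup>* X\<close>, which are real and
  nonnegative.
\<close>

definition singular_values :: "complex mat \<Rightarrow> real multiset" where
  "singular_values X =
     image_mset (\<lambda>z. sqrt (Re z)) (proots (char_poly (mat_adjoint X * X)))"

definition num_outliers :: "real \<Rightarrow> complex mat \<Rightarrow> nat" where
  "num_outliers \<epsilon> X = size {#s \<in># singular_values X. s \<notin> {0..<\<epsilon>}#}"

definition strong_cluster :: "(nat \<Rightarrow> complex mat) \<Rightarrow> (nat \<Rightarrow> complex mat) \<Rightarrow> bool" where
  "strong_cluster X Y \<longleftrightarrow>
     (\<forall>\<epsilon>>0. \<exists>N1 N2 :: nat. \<forall>n>N2. num_outliers \<epsilon> (X n - Y n) \<le> N1)"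

definition weak_cluster :: "(nat \<Rightarrow> complex mat) \<Rightarrow> (nat \<Rightarrow> complex mat) \<Rightarrow> bool" where
  "weak_cluster X Y \<longleftrightarrow>
     (\<forall>\<epsilon>>0. \<exists>(N1 :: nat \<Rightarrow> nat) N2 :: nat.
        (\<lambda>n. real (N1 n)) \<in> o(\<lambda>n. real n) \<and>
        (\<forall>n>N2. num_outliers \<epsilon> (X n - Y n) \<le> N1 n))"

text \<open>
  The restriction of \<open>T\<close> to the range of the rank \<open>n\<close> projection \<open>P\<close> as a matrix, with respect to
  some orthonormal basis of the range. Another basis gives a unitarily equivalent matrix, by the same
  unitary for all \<open>T\<close>, so the singular values do not depend on the choice.
\<close>

definition range_mat ::
    "nat \<Rightarrow> 'a::complex_hilbert_space operator \<Rightarrow> 'a operator \<Rightarrow> complex mat" where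
  "range_mat n P T =
     (let e = (SOME e. is_onb n e (range (blinfun_apply P)))
      in Matrix.mat n n (\<lambda>(i, j). cinner (T (e j)) (e i)))"

definition strong_distribution_conv ::
    "(nat \<Rightarrow> 'a::complex_hilbert_space operator) \<Rightarrow> (nat \<Rightarrow> 'a operator \<Rightarrow> 'a operator)
      \<Rightarrow> 'a operator \<Rightarrow> bool" where
  "strong_distribution_conv P \<Phi> A \<longleftrightarrow>
     strong_cluster (\<lambda>n. range_mat n (P n) (P n o\<^sub>L \<Phi> n A o\<^sub>L P n))
                    (\<lambda>n. range_mat n (P n) (P n o\<^sub>L A o\<^sub>L P n))"

definition weak_distribution_conv ::
    "(nat \<Rightarrow> 'a::complex_hilbert_space operator) \<Rightarrow> (nat \<Rightarrow> 'a operator \<Rightarrow> 'a operator)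
      \<Rightarrow> 'a operator \<Rightarrow> bool" where
  "weak_distribution_conv P \<Phi> A \<longleftrightarrow>
     weak_cluster (\<lambda>n. range_mat n (P n) (P n o\<^sub>L \<Phi> n A o\<^sub>L P n))
                  (\<lambda>n. range_mat n (P n) (P n o\<^sub>L A o\<^sub>L P n))"

definition square_defect ::
    "'a::complex_hilbert_space operator \<Rightarrow> 'a operator \<Rightarrow> 'a operator" where
  "square_defect P A =
     (P o\<^sub>L (A o\<^sub>L A) o\<^sub>L P) - ((P o\<^sub>L A o\<^sub>L P) o\<^sub>L (P o\<^sub>L A o\<^sub>L P))"

end

theory Submission
  imports Defs
begin

text \<open>
  Call a sequence of operators \<open>X\<^sub>n\<close> negligible if for every \<open>\<epsilon> > 0\<close> and all large \<open>n\<close> one has \<open>\<parallel>X\<^sub>n x\<parallel> \<le> \<epsilon> \<parallel>x\<parallel>\<close> on a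
  subspace whose codimension is bounded in \<open>n\<close> (strong case) or \<open>o(n)\<close> (weak case). By the singular value
  decomposition, two sequences of compressed matrices converge to each other in cluster exactly when the difference
  of the compressed operators is negligible (\<open>cluster_iff_negligible\<close>). Negligible sequences are closed under
  sums, uniform limits and products with uniformly bounded sequences. Both cases of the theorem are treated at once, with the class of
  admissible bounds on the codimension as a parameter. Write \<open>X \<approx> Y\<close> if \<open>X - Y\<close> is negligible.

  The maps \<open>\<Psi>\<^sub>n(T) = P\<^sub>n \<Phi>\<^sub>n(T) P\<^sub>n\<close> and the compressions \<open>C\<^sub>n(T) = P\<^sub>n T P\<^sub>n\<close> are both completely positive
  contractions. For such a map \<open>\<Theta>\<close>, positivity on a three by three Gram matrix gives
  \<open>\<parallel>(\<Theta>(S T) - \<Theta>(S) \<Theta>(T)) x\<parallel>\<^sup>2 \<le> (\<parallel>S\<parallel>\<^sup>2 + 1) \<parallel>(\<Theta>(T\<^sup>* T) - \<Theta>(T\<^sup>*) \<Theta>(T)) x\<parallel> \<parallel>x\<parallel>\<close>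
  (\<open>schwarz_defect_bound\<close>). So if the Schwarz defect of \<open>T\<close> is negligible, then \<open>T\<close> belongs to the
  asymptotic multiplicative domain: \<open>\<Theta>\<^sub>n(S T) \<approx> \<Theta>\<^sub>n(S) \<Theta>\<^sub>n(T)\<close> for all \<open>S\<close>. That domain is a norm-closed linear space and
  contains the products of its members that have adjoints.

  For a generator \<open>A\<close>, the assumption on \<open>P\<^sub>n A\<^sup>2 P\<^sub>n - (P\<^sub>n A P\<^sub>n)\<^sup>2\<close> says that the Schwarz defect of \<open>A\<close> for \<open>C\<^sub>n\<close> is
  negligible, and the convergence at \<open>A\<close> and \<open>A\<^sup>2\<close> transfers this to \<open>\<Psi>\<^sub>n\<close>. On the intersection of the two multiplicative
  domains, \<open>\<Psi>(S) \<approx> C(S)\<close> and \<open>\<Psi>(T) \<approx> C(T)\<close> imply \<open>\<Psi>(S T) \<approx> \<Psi>(S) \<Psi>(T) \<approx> C(S) C(T) \<approx> C(S T)\<close>. The operators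
  which, together with their adjoints, lie in both domains and satisfy \<open>\<Psi>(T) \<approx> C(T)\<close> therefore form a
  \<open>C\<^sup>*\<close>-algebra (\<open>cstar_subalgebra_agreeing_algebra\<close>). It contains the generators, hence the algebra that they generate.
\<close>

section \<open>Orthonormal bases in complex Hilbert spaces\<close>

lemma cinner_add_right: "cinner x (y + z) = cinner x y + cinner x (z :: 'a::complex_hilbert_space)"
  by (metis cinner_add_left cinner_commute complex_cnj_add)

lemma cinner_zero_left [simp]: "cinner 0 (x :: 'a::complex_hilbert_space) = 0"
  using cinner_add_left[of 0 0 x] by simp

lemma cinner_zero_right [simp]: "cinner (x :: 'a::complex_hilbert_space) 0 = 0"
  using cinner_add_right[of x 0 0] by simp

lemma cinner_minus_left: "cinner (- x) y = - cinner x (y :: 'a::complex_hilbert_space)"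
  using cinner_add_left[of x "- x" y] by (simp add: add_eq_0_iff)

lemma cinner_minus_right: "cinner x (- y) = - cinner x (y :: 'a::complex_hilbert_space)"
  using cinner_add_right[of x y "- y"] by (simp add: add_eq_0_iff)

lemma cinner_diff_left: "cinner (x - y) z = cinner x z - cinner y (z :: 'a::complex_hilbert_space)"
  using cinner_add_left[of x "- y" z] by (simp add: cinner_minus_left)

lemma cinner_diff_right: "cinner x (y - z) = cinner x y - cinner x (z :: 'a::complex_hilbert_space)"
  using cinner_add_right[of x y "- z"] by (simp add: cinner_minus_right)

lemma cinner_sum_left: "cinner (\<Sum>i\<in>I. f i) (y :: 'a::complex_hilbert_space) = (\<Sum>i\<in>I. cinner (f i) y)"
  by (induction I rule: infinite_finite_induct) (simp_all add: cinner_add_left)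

lemma cinner_sum_right: "cinner (x :: 'a::complex_hilbert_space) (\<Sum>i\<in>I. f i) = (\<Sum>i\<in>I. cinner x (f i))"
  by (induction I rule: infinite_finite_induct) (simp_all add: cinner_add_right)

lemma cinner_self: "cinner x (x :: 'a::complex_hilbert_space) = complex_of_real ((norm x)\<^sup>2)"
proof -
  have "Im (cinner x x) = 0"
    using arg_cong[OF cinner_commute[of x x], of Im] by simp
  moreover have "Re (cinner x x) = (norm x)\<^sup>2"
    by (simp add: norm_eq_sqrt_cinner cinner_ge_zero)
  ultimately show ?thesis
    by (simp add: complex_eq_iff)
qed

lemma cinner_self_eq_0_iff: "cinner x x = 0 \<longleftrightarrow> x = (0 :: 'a::complex_hilbert_space)"
  by (simp add: cinner_self)

lemma Re_cinner_commute: "Re (cinner x y) = Re (cinner y (x :: 'a::complex_hilbert_space))"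
  by (subst cinner_commute) simp

lemma norm_add_sq:
  "(norm (x + y))\<^sup>2 = (norm x)\<^sup>2 + (norm y)\<^sup>2 + 2 * Re (cinner x (y :: 'a::complex_hilbert_space))"
proof -
  have "Re (cinner (x + y) (x + y)) = Re (cinner x x) + Re (cinner y y) + 2 * Re (cinner x y)"
    using Re_cinner_commute[of x y] by (simp add: cinner_add_left cinner_add_right)
  then show ?thesis
    by (simp add: cinner_self)
qed

lemma Re_cinner_le: "Re (cinner x y) \<le> norm x * norm (y :: 'a::complex_hilbert_space)"
proof -
  have "(norm (x + y))\<^sup>2 \<le> (norm x + norm y)\<^sup>2"
    by (intro power_mono norm_triangle_ineq) simp
  then show ?thesis
    by (simp add: norm_add_sq power2_sum)
qed

definition orthonormal :: "nat \<Rightarrow> (nat \<Rightarrow> 'a::complex_hilbert_space) \<Rightarrow> bool" where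
  "orthonormal n e \<longleftrightarrow> (\<forall>i<n. \<forall>j<n. cinner (e i) (e j) = (if i = j then 1 else 0))"

lemma is_onb_iff: "is_onb n e V \<longleftrightarrow> orthonormal n e \<and> complex_vector.span (e ` {..<n}) = V"
  by (simp add: is_onb_def orthonormal_def)

lemma orthonormalD: "orthonormal n e \<Longrightarrow> i < n \<Longrightarrow> j < n \<Longrightarrow> cinner (e i) (e j) = (if i = j then 1 else 0)"
  by (simp add: orthonormal_def)

lemma cinner_orthonormal_combination:
  assumes "orthonormal n e" "I \<subseteq> {..<n}" "j < n"
  shows "cinner (\<Sum>i\<in>I. c i *\<^sub>C e i) (e j) = (if j \<in> I then c j else 0)"
proof -
  have fin: "finite I"
    using assms(2) finite_subset by blast
  have "cinner (\<Sum>i\<in>I. c i *\<^sub>C e i) (e j) = (\<Sum>i\<in>I. if i = j then c i else 0)"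
    unfolding cinner_sum_left cinner_scaleC_left
    by (rule sum.cong) (use assms in \<open>auto simp: orthonormalD subset_iff\<close>)
  then show ?thesis
    using fin by simp
qed

lemma onb_expand:
  assumes "is_onb n e V" "x \<in> V"
  shows "x = (\<Sum>i<n. cinner x (e i) *\<^sub>C e i)"
proof -
  have e: "orthonormal n e" and V: "complex_vector.span (e ` {..<n}) = V"
    using assms by (auto simp: is_onb_iff)
  have "complex_vector.subspace {x. x = (\<Sum>i<n. cinner x (e i) *\<^sub>C e i)}"
  proof (rule complex_vector.subspaceI)
    fix c and x :: 'a
    assume "x \<in> {x. x = (\<Sum>i<n. cinner x (e i) *\<^sub>C e i)}"
    then have "c *\<^sub>C x = c *\<^sub>C (\<Sum>i<n. cinner x (e i) *\<^sub>C e i)"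
      by simp
    also have "\<dots> = (\<Sum>i<n. (c * cinner x (e i)) *\<^sub>C e i)"
      by (simp add: complex_vector.scale_sum_right scaleC_scaleC)
    finally show "c *\<^sub>C x \<in> {x. x = (\<Sum>i<n. cinner x (e i) *\<^sub>C e i)}"
      unfolding cinner_scaleC_left mem_Collect_eq .
  qed (auto simp: cinner_add_left scaleC_add_left sum.distrib)
  moreover have "e j = (\<Sum>i<n. cinner (e j) (e i) *\<^sub>C e i)" if "j < n" for j
  proof -
    have "(\<Sum>i<n. cinner (e j) (e i) *\<^sub>C e i) = (\<Sum>i<n. if i = j then e i else 0)"
      by (rule sum.cong) (use e that in \<open>auto simp: orthonormalD\<close>)
    then show ?thesis
      using that by simp
  qed
  ultimately have "V \<subseteq> {x. x = (\<Sum>i<n. cinner x (e i) *\<^sub>C e i)}"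
    unfolding V[symmetric] by (intro complex_vector.span_minimal) auto
  then show ?thesis
    using assms(2) by auto
qed

lemma onb_parseval:
  assumes "is_onb n e V" "x \<in> V"
  shows "cinner x y = (\<Sum>i<n. cinner x (e i) * cinner (e i) y)"
  by (subst onb_expand[OF assms]) (simp add: cinner_sum_left cinner_scaleC_left)

lemma onb_norm_sq:
  assumes "is_onb n e V" "x \<in> V"
  shows "(norm x)\<^sup>2 = (\<Sum>i<n. (cmod (cinner x (e i)))\<^sup>2)"
proof -
  have "complex_of_real ((norm x)\<^sup>2) = (\<Sum>i<n. cinner x (e i) * cnj (cinner x (e i)))"
    unfolding cinner_self[symmetric] onb_parseval[OF assms, of x] by (subst (2) cinner_commute) (rule refl)
  also have "\<dots> = complex_of_real (\<Sum>i<n. (cmod (cinner x (e i)))\<^sup>2)"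
    by (simp add: complex_norm_square del: of_real_power)
  finally show ?thesis
    using of_real_eq_iff by blast
qed

lemma onb_mem: "is_onb n e V \<Longrightarrow> i < n \<Longrightarrow> e i \<in> V"
  by (auto simp: is_onb_iff intro: complex_vector.span_base)

lemma onb_subspace: "is_onb n e V \<Longrightarrow> complex_vector.subspace V"
  by (auto simp: is_onb_iff)

lemma orthonormal_independent:
  assumes "orthonormal n e"
  shows "inj_on e {..<n}" "complex_vector.independent (e ` {..<n})"
proof -
  have neq: "e i \<noteq> e j" if "i < n" "j < n" "i \<noteq> j" for i j
    using orthonormalD[OF assms that(1,2)] orthonormalD[OF assms that(1,1)] that(3) by auto
  then show inj: "inj_on e {..<n}"
    by (auto simp: inj_on_def)
  show "complex_vector.independent (e ` {..<n})"
  proof (rule complex_vector.independent_if_scalars_zero)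
    fix f x
    assume eq: "(\<Sum>x\<in>e ` {..<n}. f x *\<^sub>C x) = 0" and "x \<in> e ` {..<n}"
    then obtain j where j: "j < n" "x = e j"
      by auto
    have "(\<Sum>i<n. f (e i) *\<^sub>C e i) = 0"
      using eq by (simp add: sum.reindex[OF inj])
    then have "cinner (\<Sum>i<n. f (e i) *\<^sub>C e i) (e j) = 0"
      by simp
    then show "f x = 0"
      using cinner_orthonormal_combination[OF assms subset_refl, of j "\<lambda>i. f (e i)"] j by simp
  qed simp
qed

lemma onb_dim: "is_onb n e V \<Longrightarrow> complex_vector.dim V = n"
  using orthonormal_independent[of n e]
  by (metis is_onb_iff card_image card_lessThan complex_vector.dim_span_eq_card_independent)

text \<open>The Gram--Schmidt step: normalise what remains of \<open>x\<close> after its projection onto the family is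
  subtracted. A vector that is already in the span leaves no remainder, so the new family need not be longer.\<close>

lemma orthonormal_extend_vector:
  fixes e :: "nat \<Rightarrow> 'a::complex_hilbert_space"
  assumes e: "orthonormal k e"
  obtains n e' where "k \<le> n" "\<And>i. i < k \<Longrightarrow> e' i = e i"
    "is_onb n e' (complex_vector.span (insert x (e ` {..<k})))"
proof -
  define p where "p = (\<Sum>i<k. cinner x (e i) *\<^sub>C e i)"
  have p_span: "p \<in> complex_vector.span (e ` {..<k})"
    unfolding p_def by (intro complex_vector.span_sum complex_vector.span_scale complex_vector.span_base) auto
  define r where "r = x - p"
  have r_orth: "cinner r (e j) = 0" if "j < k" for j
    using cinner_orthonormal_combination[OF e subset_refl that] that
    by (simp add: r_def p_def cinner_diff_left)
  have span_x: "complex_vector.span (insert r (e ` {..<k})) = complex_vector.span (insert x (e ` {..<k}))"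
  proof -
    have "x = r + p"
      by (simp add: r_def)
    then have "x \<in> complex_vector.span (insert r (e ` {..<k}))"
      using p_span complex_vector.span_mono[of "e ` {..<k}" "insert r (e ` {..<k})"]
      by (metis complex_vector.span_add complex_vector.span_base insertI1 subsetD subset_insertI)
    moreover have "r \<in> complex_vector.span (insert x (e ` {..<k}))"
      using p_span complex_vector.span_mono[of "e ` {..<k}" "insert x (e ` {..<k})"] r_def
      by (metis complex_vector.span_diff complex_vector.span_base insertI1 subsetD subset_insertI)
    ultimately show ?thesis
      by (auto simp: complex_vector.span_eq intro: complex_vector.span_base)
  qed
  show ?thesis
  proof (cases "r = 0")
    case True
    then have "complex_vector.span (insert x (e ` {..<k})) = complex_vector.span (e ` {..<k})"
      using span_x by (simp add: complex_vector.span_insert_0)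
    then show ?thesis
      using that[of k e] e by (simp add: is_onb_iff)
  next
    case False
    define u where "u = complex_of_real (inverse (norm r)) *\<^sub>C r"
    define e' where "e' i = (if i < k then e i else u)" for i
    have "norm u = 1"
      using False by (simp add: u_def norm_scaleC norm_inverse)
    then have uu: "cinner u u = 1"
      by (simp add: cinner_self)
    have ue: "cinner u (e j) = 0" "cinner (e j) u = 0" if "j < k" for j
      using r_orth[OF that] cinner_commute[of "e j" u] by (simp_all add: u_def cinner_scaleC_left)
    have on: "orthonormal (Suc k) e'"
      using e uu ue by (auto simp: orthonormal_def e'_def less_Suc_eq)
    have img: "e' ` {..<Suc k} = insert u (e ` {..<k})"
      by (auto simp: e'_def lessThan_Suc)
    have "r = complex_of_real (norm r) *\<^sub>C u"
      using False by (simp add: u_def scaleC_scaleC flip: of_real_mult)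
    then have "r \<in> complex_vector.span (insert u (e ` {..<k}))"
      by (metis complex_vector.span_scale complex_vector.span_base insertI1)
    moreover have "u \<in> complex_vector.span (insert r (e ` {..<k}))"
      unfolding u_def by (intro complex_vector.span_scale complex_vector.span_base) simp
    ultimately have "complex_vector.span (insert u (e ` {..<k})) = complex_vector.span (insert r (e ` {..<k}))"
      by (auto simp: complex_vector.span_eq intro: complex_vector.span_base)
    then have "is_onb (Suc k) e' (complex_vector.span (insert x (e ` {..<k})))"
      using on img span_x by (simp add: is_onb_iff)
    then show ?thesis
      using that[of "Suc k" e'] by (auto simp: e'_def)
  qed
qed

lemma orthonormal_extend:
  fixes e :: "nat \<Rightarrow> 'a::complex_hilbert_space"
  assumes "finite B" "orthonormal k e"
  shows "\<exists>n e'. k \<le> n \<and> (\<forall>i<k. e' i = e i) \<and> is_onb n e' (complex_vector.span (B \<union> e ` {..<k}))"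
  using assms(1)
proof (induction B)
  case empty
  show ?case
    using assms(2) by (intro exI[of _ k] exI[of _ e]) (simp add: is_onb_iff)
next
  case (insert x B)
  then obtain n e' where *: "k \<le> n" "\<forall>i<k. e' i = e i"
    "is_onb n e' (complex_vector.span (B \<union> e ` {..<k}))"
    by blast
  obtain n' e'' where **: "n \<le> n'" "\<And>i. i < n \<Longrightarrow> e'' i = e' i"
    "is_onb n' e'' (complex_vector.span (insert x (e' ` {..<n})))"
    using orthonormal_extend_vector[of n e' x] *(3) by (auto simp: is_onb_iff)
  have "complex_vector.span (e' ` {..<n}) = complex_vector.span (B \<union> e ` {..<k})"
    using *(3) by (simp add: is_onb_iff)
  then have "complex_vector.span (insert x (e' ` {..<n})) = complex_vector.span (insert x (B \<union> e ` {..<k}))"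
    by (simp add: complex_vector.span_insert)
  then show ?case
    using * ** by (intro exI[of _ n'] exI[of _ e'']) auto
qed

text \<open>All orthonormal bases of a space have as many vectors as its dimension, so the extension ends at exactly \<open>n\<close>.\<close>

lemma orthonormal_extend_onb:
  assumes "is_onb n e V" "orthonormal k g" "g ` {..<k} \<subseteq> V"
  obtains g' where "k \<le> n" "\<And>i. i < k \<Longrightarrow> g' i = g i" "is_onb n g' V"
proof -
  obtain n' g' where *: "k \<le> n'" "\<forall>i<k. g' i = g i"
    "is_onb n' g' (complex_vector.span (e ` {..<n} \<union> g ` {..<k}))"
    using orthonormal_extend[of "e ` {..<n}" k g] assms(2) by auto
  have "complex_vector.span (e ` {..<n} \<union> g ` {..<k}) = V"
    using assms(1,3) unfolding is_onb_iff
    by (intro subset_antisym complex_vector.span_minimal)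
      (auto intro: complex_vector.span_base complex_vector.span_mono[THEN subsetD])
  with * have onb: "is_onb n' g' V"
    by simp
  then have "n' = n"
    using onb_dim assms(1) by metis
  with onb * show thesis
    using that by blast
qed

lemma onb_exists:
  fixes V :: "'a::complex_hilbert_space set"
  assumes "complex_vector.subspace V" "complex_vector.dim V = n" "n \<ge> 1"
  shows "\<exists>e. is_onb n e V"
proof -
  obtain B where B: "B \<subseteq> V" "complex_vector.independent B" "V \<subseteq> complex_vector.span B" "card B = n"
    using complex_vector.basis_exists[of V] assms(2) by metis
  (* a positive cardinality certifies that the basis is finite *)
  have fin: "finite B"
    using B(4) assms(3) card.infinite by fastforce
  have span: "complex_vector.span B = V"
    using B assms(1) by (simp add: complex_vector.span_minimal subset_antisym)
  obtain n' e where e: "is_onb n' e V"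
    using orthonormal_extend[OF fin, of 0 "\<lambda>_. 0"] span by (auto simp: orthonormal_def)
  then show ?thesis
    using onb_dim assms(2) by metis
qed

section \<open>Bounded operators and adjoints\<close>

lemma bounded_opsD: "T \<in> bounded_ops \<Longrightarrow> T (c *\<^sub>C x) = c *\<^sub>C T x"
  by (simp add: bounded_ops_def)

lemma bounded_ops_compose: "S \<in> bounded_ops \<Longrightarrow> T \<in> bounded_ops \<Longrightarrow> S o\<^sub>L T \<in> bounded_ops"
  by (simp add: bounded_ops_def)

lemma op_compose_assoc: "(R o\<^sub>L S) o\<^sub>L T = R o\<^sub>L (S o\<^sub>L T)"
  by (rule blinfun_eqI) simp

lemma op_compose_id [simp]: "id_blinfun o\<^sub>L T = T" "T o\<^sub>L id_blinfun = T"
  by (rule blinfun_eqI, simp)+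

lemma bounded_ops_add: "S \<in> bounded_ops \<Longrightarrow> T \<in> bounded_ops \<Longrightarrow> S + T \<in> bounded_ops"
  by (simp add: bounded_ops_def blinfun.add_left scaleC_add_right)

lemma bounded_ops_scaleC: "T \<in> bounded_ops \<Longrightarrow> scaleC_op c T \<in> bounded_ops"
  by (simp add: bounded_ops_def scaleC_op.rep_eq scaleC_scaleC mult.commute)

lemma bounded_ops_0: "0 \<in> bounded_ops"
  by (simp add: bounded_ops_def)

lemma bounded_ops_id: "id_blinfun \<in> bounded_ops"
  by (simp add: bounded_ops_def)

lemma scaleC_op_minus1: "scaleC_op (- 1) T = - (T :: 'a::complex_hilbert_space operator)"
  by (rule blinfun_eqI) (simp add: scaleC_op.rep_eq blinfun.minus_left)

lemma bounded_ops_diff: "S \<in> bounded_ops \<Longrightarrow> T \<in> bounded_ops \<Longrightarrow> S - T \<in> bounded_ops"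
  using bounded_ops_add[of S "- T"] bounded_ops_scaleC[of T "- 1"] by (simp add: scaleC_op_minus1)

lemma bounded_ops_sum:
  "T \<in> bounded_ops \<Longrightarrow> T (\<Sum>i\<in>I. c i *\<^sub>C x i) = (\<Sum>i\<in>I. c i *\<^sub>C T (x i))"
  by (simp add: blinfun.sum_right bounded_opsD)

lemma is_adjointD: "is_adjoint T S \<Longrightarrow> cinner (T x) y = cinner x (S y)"
  by (simp add: is_adjoint_def)

lemma is_adjoint_sym: "is_adjoint T S \<Longrightarrow> is_adjoint S T"
  unfolding is_adjoint_def by (metis cinner_commute)

lemma is_adjointD': "is_adjoint T S \<Longrightarrow> cinner (S x) y = cinner x (T y)"
  using is_adjointD is_adjoint_sym by blast

lemma is_adjoint_unique:
  fixes S S' T :: "'a::complex_hilbert_space operator"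
  assumes "is_adjoint T S" "is_adjoint T S'"
  shows "S = S'"
proof (rule blinfun_eqI)
  fix y
  have "cinner (S y - S' y) (S y - S' y) = 0"
    using is_adjointD[OF assms(1)] is_adjointD[OF assms(2)] by (simp add: cinner_diff_right)
  then show "S y = S' y"
    by (simp only: cinner_self_eq_0_iff) simp
qed

lemma is_adjoint_add: "is_adjoint S S' \<Longrightarrow> is_adjoint T T' \<Longrightarrow> is_adjoint (S + T) (S' + T')"
  by (simp add: is_adjoint_def bounded_ops_add blinfun.add_left cinner_add_left cinner_add_right)

lemma is_adjoint_compose: "is_adjoint S S' \<Longrightarrow> is_adjoint T T' \<Longrightarrow> is_adjoint (S o\<^sub>L T) (T' o\<^sub>L S')"
  by (simp add: is_adjoint_def bounded_ops_compose)

lemma is_adjoint_scaleC: "is_adjoint T T' \<Longrightarrow> is_adjoint (scaleC_op c T) (scaleC_op (cnj c) T')"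
  by (simp add: is_adjoint_def bounded_ops_scaleC scaleC_op.rep_eq cinner_scaleC_left cinner_scaleC_right)

lemma is_adjoint_0: "is_adjoint 0 (0 :: 'a::complex_hilbert_space operator)"
  by (simp add: is_adjoint_def bounded_ops_0)

lemma is_adjoint_diff: "is_adjoint S S' \<Longrightarrow> is_adjoint T T' \<Longrightarrow> is_adjoint (S - T) (S' - T')"
  by (simp add: is_adjoint_def bounded_ops_diff blinfun.diff_left cinner_diff_left cinner_diff_right)

lemma is_adjoint_id: "is_adjoint id_blinfun (id_blinfun :: 'a::complex_hilbert_space operator)"
  by (simp add: is_adjoint_def bounded_ops_id)

lemma norm_is_adjoint_le:
  assumes "is_adjoint T (S :: 'a::complex_hilbert_space operator)"
  shows "norm S \<le> norm T"
proof (rule norm_blinfun_bound)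
  fix y
  have "(norm (S y))\<^sup>2 = Re (cinner (T (S y)) y)"
    using is_adjointD[OF assms, of "S y" y] by (simp add: cinner_self)
  also have "\<dots> \<le> norm (T (S y)) * norm y"
    by (rule Re_cinner_le)
  also have "\<dots> \<le> norm T * norm (S y) * norm y"
    by (intro mult_right_mono norm_blinfun) simp
  finally have "norm (S y) * norm (S y) \<le> norm (S y) * (norm T * norm y)"
    by (simp add: power2_eq_square ac_simps)
  then show "norm (S y) \<le> norm T * norm y"
    by (cases "norm (S y) = 0") auto
qed simp

lemma norm_is_adjoint: "is_adjoint T (S :: 'a::complex_hilbert_space operator) \<Longrightarrow> norm S = norm T"
  using norm_is_adjoint_le is_adjoint_sym by (meson order_antisym)

text \<open>The adjoint is isometric, so the adjoints of a convergent sequence converge as well.\<close>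

lemma is_adjoint_limit:
  fixes X :: "nat \<Rightarrow> 'a::complex_hilbert_space operator"
  assumes adj: "\<And>k. is_adjoint (X k) (Y k)" and X: "X \<longlonglongrightarrow> T"
  shows "\<exists>S. Y \<longlonglongrightarrow> S \<and> is_adjoint T S"
proof -
  have "Cauchy X"
    using X LIMSEQ_imp_Cauchy by blast
  moreover have "dist (Y i) (Y j) = dist (X i) (X j)" for i j
    unfolding dist_norm using norm_is_adjoint[OF is_adjoint_diff[OF adj adj]] .
  ultimately have "Cauchy Y"
    by (simp add: Cauchy_def)
  then obtain S where S: "Y \<longlonglongrightarrow> S"
    using Cauchy_convergent convergent_def by blast
  have lim: "(\<lambda>k. X k x) \<longlonglongrightarrow> T x" "(\<lambda>k. Y k x) \<longlonglongrightarrow> S x" for x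
    using X S by (auto intro!: tendsto_intros)
  have lim_cinner: "(\<lambda>k. cinner (x k) y) \<longlonglongrightarrow> cinner x0 y" if "x \<longlonglongrightarrow> x0" for x x0 and y :: 'a
  proof (rule Lim_null_comparison[THEN LIM_zero_cancel])
    have "cmod (cinner z y) \<le> 2 * (norm z * norm y)" for z
    proof -
      have le: "\<bar>Re (cinner z y)\<bar> \<le> norm z * norm y" for z
        using Re_cinner_le[of z y] Re_cinner_le[of "- z" y] by (simp add: cinner_minus_left)
      have "Im (cinner z y) = Re (cinner (- \<i> *\<^sub>C z) y)"
        by (simp add: cinner_scaleC_left cinner_minus_left)
      then have "\<bar>Im (cinner z y)\<bar> \<le> norm z * norm y"
        using le[of "- \<i> *\<^sub>C z"] by (simp add: norm_scaleC del: complex_vector.scale_minus_left)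
      then show ?thesis
        using le[of z] cmod_le[of "cinner z y"] by simp
    qed
    then show "\<forall>\<^sub>F k in sequentially. norm (cinner (x k) y - cinner x0 y) \<le> 2 * (norm (x k - x0) * norm y)"
      by (simp flip: cinner_diff_left)
    show "(\<lambda>k. 2 * (norm (x k - x0) * norm y)) \<longlonglongrightarrow> 0"
      using that by (auto intro!: tendsto_eq_intros simp: LIM_zero)
  qed
  have "cinner (T x) y = cinner x (S y)" for x y
  proof (rule LIMSEQ_unique)
    show "(\<lambda>k. cinner (X k x) y) \<longlonglongrightarrow> cinner (T x) y"
      by (intro lim_cinner lim)
    have "(\<lambda>k. cnj (cinner (Y k y) x)) \<longlonglongrightarrow> cnj (cinner (S y) x)"
      by (intro tendsto_cnj lim_cinner lim)
    then show "(\<lambda>k. cinner (X k x) y) \<longlonglongrightarrow> cinner x (S y)"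
      by (simp add: is_adjointD[OF adj] flip: cinner_commute)
  qed
  moreover have "T \<in> bounded_ops" if "X \<longlonglongrightarrow> T" "\<And>k. X k \<in> bounded_ops" for X :: "nat \<Rightarrow> 'a operator" and T
  proof -
    have lim: "(\<lambda>k. X k x) \<longlonglongrightarrow> T x" for x
      using that(1) by (auto intro!: tendsto_intros)
    have "bounded_linear (\<lambda>x::'a. c *\<^sub>C x)" for c
      using blinfun.bounded_linear_right[of "scaleC_op c id_blinfun"] by (simp add: scaleC_op.rep_eq)
    then have "(\<lambda>k. c *\<^sub>C X k x) \<longlonglongrightarrow> c *\<^sub>C T x" for c x
      using lim by (rule bounded_linear.tendsto)
    then have "T (c *\<^sub>C x) = c *\<^sub>C T x" for c x
      using lim[of "c *\<^sub>C x"] that(2) by (intro LIMSEQ_unique) (auto simp: bounded_opsD)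
    then show ?thesis
      by (simp add: bounded_ops_def)
  qed
  ultimately have "is_adjoint T S"
    using X S adj by (simp add: is_adjoint_def)
  with S show ?thesis
    by blast
qed

lemma self_adjointD: "self_adjoint T \<Longrightarrow> is_adjoint T T"
  by (simp add: self_adjoint_def)

lemma projection_norm_le:
  assumes "orthogonal_projection P"
  shows "norm P \<le> 1"
proof (rule norm_blinfun_bound)
  fix x
  have adj: "is_adjoint P P" and idem: "P (P x) = P x"
    using assms blinfun_apply_blinfun_compose[of P P x] by (auto simp: orthogonal_projection_def self_adjoint_def)
  have "(norm (P x))\<^sup>2 = Re (cinner (P x) x)"
    using is_adjointD[OF adj, of "P x" x] idem by (simp add: cinner_self)
  also have "\<dots> \<le> norm (P x) * norm x"
    by (rule Re_cinner_le)
  finally show "norm (P x) \<le> 1 * norm x"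
    by (cases "norm (P x) = 0") (auto simp: power2_eq_square)
qed simp

section \<open>Singular values of compressions\<close>

definition image_orthogonal :: "'a::complex_hilbert_space operator \<Rightarrow> nat \<Rightarrow> (nat \<Rightarrow> 'a) \<Rightarrow> bool" where
  "image_orthogonal T n g \<longleftrightarrow> (\<forall>i<n. \<forall>j<n. i \<noteq> j \<longrightarrow> cinner (T (g i)) (T (g j)) = 0)"

lemma eigenvector_exists:
  fixes H :: "complex mat"
  assumes H: "H \<in> carrier_mat n n" and n: "n \<noteq> 0"
  obtains v \<mu> where "v \<in> carrier_vec n" "v \<noteq> 0\<^sub>v n" "H *\<^sub>v v = \<mu> \<cdot>\<^sub>v v"
proof -
  have "degree (char_poly H) = n"
    using degree_monic_char_poly[OF H] by blast
  then have "\<not> constant (poly (char_poly H))"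
    using n by (simp add: constant_degree)
  then obtain \<mu> where "poly (char_poly H) \<mu> = 0"
    using fundamental_theorem_of_algebra by blast
  then have "eigenvalue H \<mu>"
    by (simp add: eigenvalue_root_char_poly[OF H])
  then show thesis
    using that H by (auto simp: eigenvalue_def eigenvector_def)
qed

text \<open>The form \<open>\<langle>T x, T y\<rangle>\<close> on a finite-dimensional space is represented by a matrix, and an eigenvector of that matrix
  is a vector \<open>g\<close> with \<open>\<langle>T g, T y\<rangle> = \<mu> \<langle>g, y\<rangle>\<close> for all \<open>y\<close> in the space.\<close>

lemma form_eigenvector:
  assumes T: "T \<in> bounded_ops" and e: "is_onb n e V" and n: "n \<noteq> 0"
  obtains g \<mu> where "g \<in> V" "norm g = 1" "\<And>y. y \<in> V \<Longrightarrow> cinner (T g) (T y) = \<mu> * cinner g y"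
proof -
  define H where "H = Matrix.mat n n (\<lambda>(i, j). cinner (T (e j)) (T (e i)))"
  have "H \<in> carrier_mat n n"
    by (simp add: H_def)
  then obtain v \<mu> where v: "v \<in> carrier_vec n" "v \<noteq> 0\<^sub>v n" and eig: "H *\<^sub>v v = \<mu> \<cdot>\<^sub>v v"
    using eigenvector_exists n by blast
  define x where "x = (\<Sum>j<n. (v $ j) *\<^sub>C e j)"
  have on: "orthonormal n e"
    using e by (simp add: is_onb_iff)
  have coeff: "cinner x (e i) = v $ i" if "i < n" for i
    using cinner_orthonormal_combination[OF on subset_refl that] that by (simp add: x_def)
  have "x \<noteq> 0"
  proof
    assume "x = 0"
    then have "v = 0\<^sub>v n"
      using v(1) coeff by (intro eq_vecI) auto
    then show False
      using v(2) by simp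
  qed
  have basis: "cinner (T x) (T (e i)) = \<mu> * cinner x (e i)" if i: "i < n" for i
  proof -
    have "cinner (T x) (T (e i)) = (\<Sum>j<n. v $ j * cinner (T (e j)) (T (e i)))"
      by (simp add: x_def bounded_ops_sum[OF T] cinner_sum_left cinner_scaleC_left)
    also have "\<dots> = (H *\<^sub>v v) $ i"
      using i v(1) by (simp add: H_def scalar_prod_def atLeast0LessThan mult.commute)
    also have "\<dots> = \<mu> * cinner x (e i)"
      using i v(1) by (simp add: eig coeff)
    finally show ?thesis .
  qed
  have form: "cinner (T x) (T y) = \<mu> * cinner x y" if "y \<in> V" for y
  proof -
    have y: "y = (\<Sum>i<n. cinner y (e i) *\<^sub>C e i)"
      by (rule onb_expand[OF e that])
    have "cinner (T x) (T (\<Sum>i<n. c i *\<^sub>C e i)) = \<mu> * cinner x (\<Sum>i<n. c i *\<^sub>C e i)" for c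
      by (simp add: bounded_ops_sum[OF T] cinner_sum_right cinner_scaleC_right basis sum_distrib_left ac_simps)
    then show ?thesis
      using y by metis
  qed
  define g where "g = complex_of_real (inverse (norm x)) *\<^sub>C x"
  show thesis
  proof (rule that)
    have "x \<in> V"
      unfolding x_def using onb_subspace[OF e] onb_mem[OF e]
      by (intro complex_vector.subspace_sum complex_vector.subspace_scale) auto
    then show "g \<in> V"
      using onb_subspace[OF e] by (simp add: g_def complex_vector.subspace_scale)
    show "norm g = 1"
      using \<open>x \<noteq> 0\<close> by (simp add: g_def norm_scaleC norm_inverse)
    show "cinner (T g) (T y) = \<mu> * cinner g y" if "y \<in> V" for y
      using form[OF that] by (simp only: g_def bounded_opsD[OF T] cinner_scaleC_left ac_simps)
  qed
qed

text \<open>The singular value decomposition on a finite-dimensional space, by splitting off one right singular vector at a time: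
  what is orthogonal to an eigenvector of the form \<open>\<langle>T x, T y\<rangle>\<close> has image orthogonal to the image of that eigenvector.\<close>

lemma singular_onb_exists:
  assumes T: "T \<in> bounded_ops"
  shows "is_onb n e V \<Longrightarrow> \<exists>g. is_onb n g V \<and> image_orthogonal T n g"
proof (induction n arbitrary: e V)
  case 0
  then show ?case
    by (auto simp: image_orthogonal_def)
next
  case (Suc n)
  obtain g \<mu> where g: "g \<in> V" "norm g = 1" and form: "\<And>y. y \<in> V \<Longrightarrow> cinner (T g) (T y) = \<mu> * cinner g y"
    using form_eigenvector[OF T Suc.prems] by blast
  have "orthonormal 1 (\<lambda>_. g)"
    using g(2) by (simp add: orthonormal_def cinner_self)
  then obtain f where f: "f 0 = g" "is_onb (Suc n) f V"
    using orthonormal_extend_onb[OF Suc.prems, of 1 "\<lambda>_. g"] g(1) by (auto simp: image_subset_iff)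
  define W where "W = complex_vector.span ((\<lambda>i. f (Suc i)) ` {..<n})"
  have f_on: "orthonormal (Suc n) f" and V: "V = complex_vector.span (f ` {..<Suc n})"
    using f(2) by (auto simp: is_onb_iff)
  have "is_onb n (\<lambda>i. f (Suc i)) W"
    using f_on by (simp add: is_onb_iff orthonormal_def W_def)
  from Suc.IH[OF this] obtain h where h: "is_onb n h W" "image_orthogonal T n h"
    by blast
  have img: "f ` {..<Suc n} = insert g ((\<lambda>i. f (Suc i)) ` {..<n})"
    using f(1) by (simp add: lessThan_Suc_eq_insert_0 image_image)
  have "W \<subseteq> V"
    unfolding W_def V img by (intro complex_vector.span_mono) auto
  have W_orth: "cinner g y = 0" if "y \<in> W" for y
  proof -
    have "complex_vector.subspace {y. cinner g y = 0}"
      by (auto simp: complex_vector.subspace_def cinner_add_right cinner_scaleC_right)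
    moreover have "cinner g (f (Suc i)) = 0" if "i < n" for i
      using orthonormalD[OF f_on, of 0 "Suc i"] that f(1) by simp
    ultimately have "W \<subseteq> {y. cinner g y = 0}"
      unfolding W_def by (intro complex_vector.span_minimal) auto
    then show ?thesis
      using that by auto
  qed
  have W_orth': "cinner y g = 0" if "y \<in> W" for y
    using W_orth[OF that] cinner_commute[of y g] by simp
  have TW: "cinner (T g) (T y) = 0" "cinner (T y) (T g) = 0" if "y \<in> W" for y
    using form[of y] W_orth[OF that] that \<open>W \<subseteq> V\<close> cinner_commute[of "T y" "T g"] by auto
  define k where "k i = (case i of 0 \<Rightarrow> g | Suc i \<Rightarrow> h i)" for i
  have h_on: "orthonormal n h" and hW: "complex_vector.span (h ` {..<n}) = W"
    using h(1) by (auto simp: is_onb_iff)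
  have mem: "h i \<in> W" if "i < n" for i
    using onb_mem[OF h(1) that] .
  have "orthonormal (Suc n) k"
    unfolding orthonormal_def
  proof (intro allI impI)
    have "cinner g g = 1"
      using g(2) by (simp add: cinner_self)
    then show "cinner (k i) (k j) = (if i = j then 1 else 0)" if "i < Suc n" "j < Suc n" for i j
      using that h_on mem W_orth W_orth' by (cases i; cases j) (simp_all add: k_def orthonormalD)
  qed
  moreover have "complex_vector.span (k ` {..<Suc n}) = V"
  proof -
    have "k ` {..<Suc n} = insert g (h ` {..<n})"
      by (simp add: k_def lessThan_Suc_eq_insert_0 image_image)
    then show ?thesis
      unfolding V img by (simp add: complex_vector.span_insert hW flip: W_def)
  qed
  moreover have "image_orthogonal T (Suc n) k"
    unfolding image_orthogonal_def
  proof (intro allI impI)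
    show "cinner (T (k i)) (T (k j)) = 0" if "i < Suc n" "j < Suc n" "i \<noteq> j" for i j
      using that h(2) mem TW by (cases i; cases j) (simp_all add: k_def image_orthogonal_def)
  qed
  ultimately show ?case
    by (auto simp: is_onb_iff)
qed

lemma image_orthogonal_norm_sq:
  assumes T: "T \<in> bounded_ops" and "image_orthogonal T n g" "I \<subseteq> {..<n}"
  shows "(norm (T (\<Sum>i\<in>I. c i *\<^sub>C g i)))\<^sup>2 = (\<Sum>i\<in>I. (cmod (c i))\<^sup>2 * (norm (T (g i)))\<^sup>2)"
proof -
  have fin: "finite I"
    using assms(3) finite_subset by blast
  let ?x = "\<Sum>i\<in>I. c i *\<^sub>C T (g i)"
  have "cinner ?x ?x = (\<Sum>i\<in>I. \<Sum>j\<in>I. c i * cnj (c j) * cinner (T (g i)) (T (g j)))"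
    unfolding cinner_sum_left cinner_scaleC_left cinner_sum_right cinner_scaleC_right sum_distrib_left
    by (subst sum.swap) (simp add: ac_simps)
  also have "\<dots> = (\<Sum>i\<in>I. \<Sum>j\<in>I. if j = i then complex_of_real ((cmod (c i))\<^sup>2 * (norm (T (g i)))\<^sup>2) else 0)"
  proof (intro sum.cong refl)
    fix i j assume "i \<in> I" "j \<in> I"
    then have "i < n" "j < n"
      using assms(3) by auto
    then show "c i * cnj (c j) * cinner (T (g i)) (T (g j)) =
        (if j = i then complex_of_real ((cmod (c i))\<^sup>2 * (norm (T (g i)))\<^sup>2) else 0)"
      using assms(2) by (auto simp: image_orthogonal_def cinner_self complex_norm_square simp del: of_real_power)
  qed
  also have "\<dots> = complex_of_real (\<Sum>i\<in>I. (cmod (c i))\<^sup>2 * (norm (T (g i)))\<^sup>2)"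
    using fin by simp
  finally show ?thesis
    unfolding bounded_ops_sum[OF T] cinner_self using of_real_eq_iff by blast
qed

lemma orthonormal_norm_sq:
  assumes "orthonormal n g" "I \<subseteq> {..<n}"
  shows "(norm (\<Sum>i\<in>I. c i *\<^sub>C g i))\<^sup>2 = (\<Sum>i\<in>I. (cmod (c i))\<^sup>2)"
proof -
  have "image_orthogonal id_blinfun n g"
    using assms(1) by (auto simp: image_orthogonal_def orthonormal_def)
  moreover have "norm (g i) = 1" if "i \<in> I" for i
    using orthonormalD[OF assms(1), of i i] that assms(2) by (auto simp: norm_eq_sqrt_cinner)
  ultimately show ?thesis
    using image_orthogonal_norm_sq[OF bounded_ops_id _ assms(2), of g c] by (simp cong: sum.cong)
qed

lemma range_projection:
  assumes "orthogonal_projection P" "x \<in> range P"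
  shows "P x = x"
  using assms by (auto simp: orthogonal_projection_def simp flip: blinfun_apply_blinfun_compose)

lemma range_mat_dim: "range_mat n P T \<in> carrier_mat n n"
  by (simp add: range_mat_def Let_def)

lemma range_mat_diff: "range_mat n P S - range_mat n P T = range_mat n P (S - T)"
  by (rule eq_matI) (auto simp: range_mat_def Let_def blinfun.diff_left cinner_diff_left)

text \<open>The unitary change of basis from the chosen basis of the range to \<open>g\<close> diagonalises \<open>X\<^sup>* X\<close>, with the
  numbers \<open>\<parallel>T g\<^sub>i\<parallel>\<^sup>2\<close> on the diagonal.\<close>

lemma num_outliers_range_mat:
  assumes P: "orthogonal_projection P" and T: "T \<in> bounded_ops" and PT: "P o\<^sub>L T = T"
    and g: "is_onb n g (range P)" "image_orthogonal T n g"
  shows "num_outliers \<epsilon> (range_mat n P T) = card {i. i < n \<and> \<epsilon> \<le> norm (T (g i))}"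
proof -
  define e where "e = (SOME e. is_onb n e (range (blinfun_apply P)))"
  have e: "is_onb n e (range P)"
    unfolding e_def using g(1) by (rule someI[of "\<lambda>e. is_onb n e (range (blinfun_apply P))"])
  define X where "X = range_mat n P T"
  have X_entry: "X = Matrix.mat n n (\<lambda>(i, j). cinner (T (e j)) (e i))"
    by (simp add: X_def range_mat_def e_def Let_def)
  have Tmem: "T x \<in> range P" for x
    using PT blinfun_apply_blinfun_compose[of P T x] by (metis rangeI)
  have XX: "mat_adjoint X * X = Matrix.mat n n (\<lambda>(i, j). cinner (T (e j)) (T (e i)))"
  proof (rule eq_matI)
    fix i j assume "i < dim_row (Matrix.mat n n (\<lambda>(i, j). cinner (T (e j)) (T (e i))))"
      "j < dim_col (Matrix.mat n n (\<lambda>(i, j). cinner (T (e j)) (T (e i))))"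
    then have ij: "i < n" "j < n"
      by auto
    have "(mat_adjoint X * X) $$ (i, j) = (\<Sum>k<n. cnj (cinner (T (e i)) (e k)) * cinner (T (e j)) (e k))"
      using ij by (simp add: X_entry mat_adjoint_def scalar_prod_def atLeast0LessThan mat_of_rows_def)
    also have "\<dots> = (\<Sum>k<n. cinner (T (e j)) (e k) * cinner (e k) (T (e i)))"
      by (intro sum.cong refl) (metis cinner_commute mult.commute)
    also have "\<dots> = cinner (T (e j)) (T (e i))"
      by (rule onb_parseval[OF e Tmem, symmetric])
    finally show "(mat_adjoint X * X) $$ (i, j) = Matrix.mat n n (\<lambda>(i, j). cinner (T (e j)) (T (e i))) $$ (i, j)"
      using ij by simp
  qed (auto simp: X_entry mat_adjoint_def)
  define D where "D = Matrix.mat n n (\<lambda>(i, j). if i = j then complex_of_real ((norm (T (g i)))\<^sup>2) else 0)"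
  define U where "U = Matrix.mat n n (\<lambda>(i, j). cinner (g j) (e i))"
  define U' where "U' = Matrix.mat n n (\<lambda>(i, j). cinner (e j) (g i))"
  have e_on: "orthonormal n e" and g_on: "orthonormal n g"
    using e g(1) by (auto simp: is_onb_iff)
  have UU': "U * U' = 1\<^sub>m n"
  proof (rule eq_matI)
    fix i j assume "i < dim_row (1\<^sub>m n)" "j < dim_col (1\<^sub>m n)"
    then have ij: "i < n" "j < n"
      by auto
    have "(U * U') $$ (i, j) = (\<Sum>k<n. cinner (e j) (g k) * cinner (g k) (e i))"
      using ij by (simp add: U_def U'_def scalar_prod_def atLeast0LessThan mult.commute)
    also have "\<dots> = cinner (e j) (e i)"
      by (rule onb_parseval[OF g(1) onb_mem[OF e ij(2)], symmetric])
    finally show "(U * U') $$ (i, j) = 1\<^sub>m n $$ (i, j)"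
      using ij orthonormalD[OF e_on ij(2,1)] by auto
  qed (auto simp: U_def U'_def)
  have U'U: "U' * U = 1\<^sub>m n"
    using mat_mult_left_right_inverse[OF _ _ UU'] by (simp add: U_def U'_def)
  have "mat_adjoint X * X = U * D * U'"
  proof (rule eq_matI)
    fix i j assume "i < dim_row (U * D * U')" "j < dim_col (U * D * U')"
    then have ij: "i < n" "j < n"
      by (auto simp: U_def U'_def)
    have UD: "(U * D) $$ (i, k) = cinner (g k) (e i) * complex_of_real ((norm (T (g k)))\<^sup>2)" if "k < n" for k
    proof -
      have "(U * D) $$ (i, k) = (\<Sum>l<n. cinner (g l) (e i) * (if l = k then complex_of_real ((norm (T (g l)))\<^sup>2) else 0))"
        using ij that by (simp add: U_def D_def scalar_prod_def atLeast0LessThan)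
      also have "\<dots> = (\<Sum>l<n. if l = k then cinner (g l) (e i) * complex_of_real ((norm (T (g l)))\<^sup>2) else 0)"
        by (intro sum.cong refl) simp
      finally show ?thesis
        using that by simp
    qed
    have "(U * D * U') $$ (i, j) = (\<Sum>k<n. (U * D) $$ (i, k) * cinner (e j) (g k))"
      using ij by (simp add: U_def D_def U'_def scalar_prod_def atLeast0LessThan)
    also have "\<dots> = (\<Sum>k<n. cinner (e j) (g k) * (cinner (g k) (e i) * complex_of_real ((norm (T (g k)))\<^sup>2)))"
      by (intro sum.cong refl) (simp add: UD)
    also have "\<dots> = (\<Sum>k<n. cinner (e j) (g k) * cinner (T (g k)) (T (e i)))"
    proof (intro sum.cong refl)
      fix k assume "k \<in> {..<n}"
      then have k: "k < n"
        by simp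
      have "e i = (\<Sum>l<n. cinner (e i) (g l) *\<^sub>C g l)"
        by (rule onb_expand[OF g(1) onb_mem[OF e ij(1)]])
      then have "cinner (T (g k)) (T (e i)) = (\<Sum>l<n. cnj (cinner (e i) (g l)) * cinner (T (g k)) (T (g l)))"
        using bounded_ops_sum[OF T, of "\<lambda>l. cinner (e i) (g l)" g "{..<n}"]
        by (simp add: cinner_sum_right cinner_scaleC_right)
      also have "\<dots> = (\<Sum>l<n. if l = k then cinner (g l) (e i) * complex_of_real ((norm (T (g l)))\<^sup>2) else 0)"
        using g(2) k cinner_commute[of "g _" "e i"]
        by (intro sum.cong refl) (auto simp: image_orthogonal_def cinner_self)
      finally show "cinner (e j) (g k) * (cinner (g k) (e i) * complex_of_real ((norm (T (g k)))\<^sup>2)) =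
          cinner (e j) (g k) * cinner (T (g k)) (T (e i))"
        using k by simp
    qed
    also have "\<dots> = cinner (\<Sum>k<n. cinner (e j) (g k) *\<^sub>C T (g k)) (T (e i))"
      by (simp add: cinner_sum_left cinner_scaleC_left)
    also have "\<dots> = cinner (T (e j)) (T (e i))"
      using onb_expand[OF g(1) onb_mem[OF e ij(2)]] bounded_ops_sum[OF T, of "\<lambda>l. cinner (e j) (g l)" g "{..<n}"]
      by simp
    finally show "(mat_adjoint X * X) $$ (i, j) = (U * D * U') $$ (i, j)"
      using ij by (simp add: XX)
  qed (auto simp: XX U_def U'_def)
  then have "similar_mat (mat_adjoint X * X) D"
    by (intro similar_matI[of _ _ U U' n] UU' U'U) (auto simp: XX U_def U'_def D_def)
  then have "char_poly (mat_adjoint X * X) = char_poly D"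
    by (rule char_poly_similar)
  also have "\<dots> = (\<Prod>a\<leftarrow>diag_mat D. [:- a, 1:])"
    by (rule char_poly_upper_triangular[of _ n]) (auto simp: D_def)
  also have "diag_mat D = map (\<lambda>i. complex_of_real ((norm (T (g i)))\<^sup>2)) [0..<n]"
    by (auto simp: diag_mat_def D_def)
  finally have "char_poly (mat_adjoint X * X) = (\<Prod>i\<leftarrow>[0..<n]. [:- complex_of_real ((norm (T (g i)))\<^sup>2), 1:])"
    by (simp add: o_def)
  also have "\<dots> = (\<Prod>i=0..<n. [:- complex_of_real ((norm (T (g i)))\<^sup>2), 1:])"
    by (simp add: prod.distinct_set_conv_list flip: set_upt)
  finally have "proots (char_poly (mat_adjoint X * X)) = (\<Sum>i=0..<n. {#complex_of_real ((norm (T (g i)))\<^sup>2)#})"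
    by (simp add: proots_prod)
  then have "proots (char_poly (mat_adjoint X * X)) = image_mset (\<lambda>i. complex_of_real ((norm (T (g i)))\<^sup>2)) (mset_set {0..<n})"
    by (simp add: sum_unfold_sum_mset)
  then have "singular_values X = image_mset (\<lambda>i. norm (T (g i))) (mset_set {0..<n})"
    by (simp add: singular_values_def image_mset.compositionality o_def)
  then have "num_outliers \<epsilon> X = size (filter_mset (\<lambda>i. norm (T (g i)) \<notin> {0..<\<epsilon>}) (mset_set {0..<n}))"
    by (simp add: num_outliers_def filter_mset_image_mset)
  also have "\<dots> = card {i. i < n \<and> \<epsilon> \<le> norm (T (g i))}"
    by (simp add: not_less)
  finally show ?thesis
    by (simp add: X_def)
qed

section \<open>Operators that are small on a subspace of finite codimension\<close>

text \<open>Elimination: each equation removes one unknown, so with fewer equations than unknowns one can be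
  chosen freely.\<close>

lemma homogeneous_system_solvable:
  fixes a :: "'b \<Rightarrow> 'i \<Rightarrow> complex"
  shows "finite L \<Longrightarrow> finite I \<Longrightarrow> card L < card I \<Longrightarrow>
    \<exists>c. (\<exists>i\<in>I. c i \<noteq> 0) \<and> (\<forall>l\<in>L. (\<Sum>i\<in>I. c i * a l i) = 0)"
proof (induction L arbitrary: I a rule: finite_induct)
  case empty
  then have "I \<noteq> {}"
    by auto
  then show ?case
    by (intro exI[of _ "\<lambda>_. 1"]) auto
next
  case (insert l L)
  show ?case
  proof (cases "\<forall>i\<in>I. a l i = 0")
    case True
    then show ?thesis
      using insert.IH[of I a] insert.prems insert.hyps by auto
  next
    case False
    then obtain j where j: "j \<in> I" "a l j \<noteq> 0"
      by blast
    define b where "b l' i = a l' i - a l i / a l j * a l' j" for l' i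
    have "card L < card (I - {j})"
      using insert.prems insert.hyps j(1) by simp
    then obtain c where c: "\<exists>i\<in>I - {j}. c i \<noteq> 0" "\<forall>l'\<in>L. (\<Sum>i\<in>I - {j}. c i * b l' i) = 0"
      using insert.IH[of "I - {j}" b] insert.prems(1) by blast
    (* the value at j is chosen so that equation l holds; then the eliminated equations imply the others *)
    define d where "d i = (if i = j then - (\<Sum>i\<in>I - {j}. c i * a l i) / a l j else c i)" for i
    have sum_d: "(\<Sum>i\<in>I. d i * f i) = d j * f j + (\<Sum>i\<in>I - {j}. c i * f i)" for f
      by (subst sum.remove[OF insert.prems(1) j(1)]) (auto simp: d_def intro!: sum.cong)
    have "(\<Sum>i\<in>I. d i * a l i) = 0"
      using j(2) by (simp add: sum_d) (simp add: d_def)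
    moreover have "(\<Sum>i\<in>I. d i * a l' i) = 0" if "l' \<in> L" for l'
    proof -
      have "(\<Sum>i\<in>I - {j}. c i * b l' i) =
          (\<Sum>i\<in>I - {j}. c i * a l' i) - (\<Sum>i\<in>I - {j}. c i * a l i) / a l j * a l' j"
        by (simp add: b_def right_diff_distrib sum_subtractf sum_distrib_right sum_divide_distrib mult.assoc)
      then show ?thesis
        using c(2) that by (simp add: sum_d) (simp add: d_def)
    qed
    moreover have "\<exists>i\<in>I. d i \<noteq> 0"
      using c(1) by (auto simp: d_def)
    ultimately show ?thesis
      by (intro exI[of _ d]) auto
  qed
qed

definition linear_functional :: "('a::complex_hilbert_space \<Rightarrow> complex) \<Rightarrow> bool" where
  "linear_functional f \<longleftrightarrow> (\<forall>x y. f (x + y) = f x + f y) \<and> (\<forall>c x. f (c *\<^sub>C x) = c * f x)"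

lemma linear_functional_compose:
  "linear_functional f \<Longrightarrow> T \<in> bounded_ops \<Longrightarrow> linear_functional (\<lambda>x. f (T x))"
  by (simp add: linear_functional_def blinfun.add_right bounded_opsD)

lemma linear_functional_sum:
  assumes "linear_functional f"
  shows "f (\<Sum>i\<in>I. c i *\<^sub>C x i) = (\<Sum>i\<in>I. c i * f (x i))"
proof -
  have "f 0 = 0"
    using assms unfolding linear_functional_def by (metis add_cancel_right_right)
  then show ?thesis
    using assms by (induction I rule: infinite_finite_induct) (simp_all add: linear_functional_def)
qed

text \<open>Codimension is measured by linear functionals instead of orthogonal vectors: functionals can be pulled back along
  an operator without taking its adjoint.\<close>

definition small_off :: "real \<Rightarrow> nat \<Rightarrow> 'a::complex_hilbert_space operator \<Rightarrow> bool" where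
  "small_off \<epsilon> N T \<longleftrightarrow>
     (\<exists>L. finite L \<and> card L \<le> N \<and> (\<forall>f\<in>L. linear_functional f) \<and>
          (\<forall>x. (\<forall>f\<in>L. f x = 0) \<longrightarrow> norm (T x) \<le> \<epsilon> * norm x))"

lemma small_off_mono:
  fixes S T :: "'a::complex_hilbert_space operator"
  assumes "small_off \<epsilon> N T" "\<And>x. norm (S x) \<le> K * norm (T x) + \<delta> * norm x" "0 \<le> K" "K * \<epsilon> + \<delta> \<le> \<epsilon>'"
  shows "small_off \<epsilon>' N S"
proof -
  obtain L where L: "finite L" "card L \<le> N" "\<forall>f\<in>L. linear_functional f"
    "\<And>x. \<forall>f\<in>L. f x = 0 \<Longrightarrow> norm (T x) \<le> \<epsilon> * norm x"
    using assms(1) by (auto simp: small_off_def)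
  have "norm (S x) \<le> \<epsilon>' * norm x" if "\<forall>f\<in>L. f x = 0" for x
  proof -
    have "norm (S x) \<le> K * norm (T x) + \<delta> * norm x"
      by (rule assms(2))
    also have "\<dots> \<le> K * (\<epsilon> * norm x) + \<delta> * norm x"
      using L(4)[OF that] assms(3) by (intro add_right_mono mult_left_mono)
    also have "\<dots> = (K * \<epsilon> + \<delta>) * norm x"
      by (simp add: algebra_simps)
    also have "\<dots> \<le> \<epsilon>' * norm x"
      using assms(4) by (intro mult_right_mono) auto
    finally show ?thesis .
  qed
  then show ?thesis
    using L by (auto simp: small_off_def)
qed

lemma small_off_add:
  assumes "small_off \<epsilon> N S" "small_off \<delta> M T"
  shows "small_off (\<epsilon> + \<delta>) (N + M) (S + T)"
proof -
  obtain L where L: "finite L" "card L \<le> N" "\<forall>f\<in>L. linear_functional f"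
    "\<And>x. \<forall>f\<in>L. f x = 0 \<Longrightarrow> norm (S x) \<le> \<epsilon> * norm x"
    using assms(1) by (auto simp: small_off_def)
  obtain L' where L': "finite L'" "card L' \<le> M" "\<forall>f\<in>L'. linear_functional f"
    "\<And>x. \<forall>f\<in>L'. f x = 0 \<Longrightarrow> norm (T x) \<le> \<delta> * norm x"
    using assms(2) by (auto simp: small_off_def)
  have "norm ((S + T) x) \<le> (\<epsilon> + \<delta>) * norm x" if "\<forall>f\<in>L \<union> L'. f x = 0" for x
    using L(4)[of x] L'(4)[of x] that norm_triangle_ineq[of "S x" "T x"]
    by (simp add: blinfun.add_left distrib_right)
  moreover have "card (L \<union> L') \<le> N + M"
    using card_Un_le[of L L'] L(2) L'(2) by linarith
  ultimately show ?thesis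
    unfolding small_off_def using L(1,3) L'(1,3) by (intro exI[of _ "L \<union> L'"]) auto
qed

lemma small_off_compose_right:
  assumes "small_off \<epsilon> N T" "S \<in> bounded_ops" "norm S \<le> K" "0 \<le> \<epsilon>"
  shows "small_off (\<epsilon> * K) N (T o\<^sub>L S)"
proof -
  obtain L where L: "finite L" "card L \<le> N" "\<forall>f\<in>L. linear_functional f"
    "\<And>x. \<forall>f\<in>L. f x = 0 \<Longrightarrow> norm (T x) \<le> \<epsilon> * norm x"
    using assms(1) by (auto simp: small_off_def)
  let ?L = "(\<lambda>f x. f (S x)) ` L"
  have "norm ((T o\<^sub>L S) x) \<le> (\<epsilon> * K) * norm x" if "\<forall>f\<in>?L. f x = 0" for x
  proof -
    have "norm (T (S x)) \<le> \<epsilon> * norm (S x)"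
      using that by (intro L(4)) auto
    also have "\<dots> \<le> \<epsilon> * (K * norm x)"
      using assms(3,4)
      by (intro mult_left_mono order_trans[OF norm_blinfun] mult_right_mono) auto
    finally show ?thesis
      by (simp add: mult.assoc)
  qed
  moreover have "card ?L \<le> N"
    using card_image_le[OF L(1), of "\<lambda>f x. f (S x)"] L(2) by linarith
  ultimately show ?thesis
    unfolding small_off_def using L(1,3) linear_functional_compose[OF _ assms(2)]
    by (intro exI[of _ ?L]) auto
qed

lemma rank_projection_singular_onb:
  assumes "orthogonal_projection P" "op_rank P = n" "n \<ge> 1" "T \<in> bounded_ops"
  obtains g where "is_onb n g (range P)" "image_orthogonal T n g"
proof -
  have P: "P \<in> bounded_ops"
    using assms(1) by (simp add: orthogonal_projection_def self_adjoint_def is_adjoint_def)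
  have "complex_vector.subspace (range P)"
  proof (rule complex_vector.subspaceI)
    show "0 \<in> range P"
      using blinfun.zero_right[of P] by (metis rangeI)
    show "x + y \<in> range P" if "x \<in> range P" "y \<in> range P" for x y
      using that by (auto simp flip: blinfun.add_right)
    show "c *\<^sub>C x \<in> range P" if "x \<in> range P" for c x
      using that by (auto simp flip: bounded_opsD[OF P])
  qed
  then obtain e where "is_onb n e (range P)"
    using onb_exists[of "range P" n] assms(2,3) by (auto simp: op_rank_def)
  then show thesis
    using singular_onb_exists[OF assms(4)] that by blast
qed

text \<open>The functionals are the coefficients with respect to those right singular vectors that belong to outlying
  singular values.\<close>

lemma small_off_if_num_outliers:
  assumes P: "orthogonal_projection P" "op_rank P = n" "n \<ge> 1"
    and T: "T \<in> bounded_ops" "P o\<^sub>L T o\<^sub>L P = T"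
    and N: "num_outliers \<epsilon> (range_mat n P T) \<le> N" and \<epsilon>: "0 \<le> \<epsilon>"
  shows "small_off \<epsilon> N T"
proof -
  have adj: "is_adjoint P P" and idem: "P o\<^sub>L P = P"
    using P(1) by (auto simp: orthogonal_projection_def self_adjoint_def)
  have PT: "P o\<^sub>L T = T" and TP: "T o\<^sub>L P = T"
    using T(2) idem by (metis op_compose_assoc)+
  obtain g where g: "is_onb n g (range P)" "image_orthogonal T n g"
    using rank_projection_singular_onb[OF P T(1)] .
  define J where "J = {i. i < n \<and> \<epsilon> \<le> norm (T (g i))}"
  define L where "L = (\<lambda>i x. cinner x (g i)) ` J"
  have "card J \<le> N"
    using N num_outliers_range_mat[OF P(1) T(1) PT g] by (simp add: J_def)
  then have "card L \<le> N"
    unfolding L_def using card_image_le[of J "\<lambda>i x. cinner x (g i)"] by (simp add: J_def)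
  moreover have "norm (T x) \<le> \<epsilon> * norm x" if x: "\<forall>f\<in>L. f x = 0" for x
  proof -
    define c where "c i = cinner x (g i)" for i
    have coeff: "cinner (P x) (g i) = c i" if "i < n" for i
      using is_adjointD[OF adj, of x "g i"] range_projection[OF P(1) onb_mem[OF g(1) that]] by (simp add: c_def)
    have "P x = (\<Sum>i<n. c i *\<^sub>C g i)"
      using onb_expand[OF g(1), of "P x"] coeff by simp
    moreover have "T x = T (P x)"
      using TP by (metis blinfun_apply_blinfun_compose)
    ultimately have "(norm (T x))\<^sup>2 = (\<Sum>i<n. (cmod (c i))\<^sup>2 * (norm (T (g i)))\<^sup>2)"
      using image_orthogonal_norm_sq[OF T(1) g(2) subset_refl, of c] by simp
    also have "\<dots> \<le> (\<Sum>i<n. (cmod (c i))\<^sup>2 * \<epsilon>\<^sup>2)"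
    proof (rule sum_mono)
      fix i assume "i \<in> {..<n}"
      show "(cmod (c i))\<^sup>2 * (norm (T (g i)))\<^sup>2 \<le> (cmod (c i))\<^sup>2 * \<epsilon>\<^sup>2"
      proof (cases "i \<in> J")
        case True
        then have "c i = 0"
          using x by (auto simp: L_def c_def)
        then show ?thesis
          by simp
      next
        case False
        then have "norm (T (g i)) \<le> \<epsilon>"
          using \<open>i \<in> {..<n}\<close> by (simp add: J_def)
        then show ?thesis
          by (intro mult_left_mono power_mono) auto
      qed
    qed
    also have "\<dots> = \<epsilon>\<^sup>2 * (norm (P x))\<^sup>2"
      using onb_norm_sq[OF g(1), of "P x"] coeff by (simp add: sum_distrib_left mult.commute)
    also have "\<dots> \<le> \<epsilon>\<^sup>2 * (norm x)\<^sup>2"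
    proof -
      have "norm (P x) \<le> norm P * norm x"
        by (rule norm_blinfun)
      also have "\<dots> \<le> 1 * norm x"
        by (intro mult_right_mono projection_norm_le P(1)) simp
      finally show ?thesis
        by (intro mult_left_mono power_mono) auto
    qed
    finally have "(norm (T x))\<^sup>2 \<le> (\<epsilon> * norm x)\<^sup>2"
      by (simp add: power_mult_distrib)
    then show ?thesis
      by (rule power2_le_imp_le) (use \<epsilon> in simp)
  qed
  moreover have "finite L" "\<forall>f\<in>L. linear_functional f"
    by (auto simp: L_def J_def linear_functional_def cinner_add_left cinner_scaleC_left)
  ultimately show ?thesis
    unfolding small_off_def by blast
qed

text \<open>If there were more outlying singular values than functionals, a nonzero combination of their right singular
  vectors would be annihilated by all functionals; on that vector the operator is not small.\<close>

lemma num_outliers_if_small_off: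
  assumes P: "orthogonal_projection P" "op_rank P = n" "n \<ge> 1"
    and T: "T \<in> bounded_ops" "P o\<^sub>L T o\<^sub>L P = T"
    and small: "small_off \<delta> N T" and "0 \<le> \<delta>" "\<delta> < \<epsilon>"
  shows "num_outliers \<epsilon> (range_mat n P T) \<le> N"
proof (rule ccontr)
  assume contra: "\<not> ?thesis"
  have "P o\<^sub>L P = P"
    using P(1) by (auto simp: orthogonal_projection_def)
  then have PT: "P o\<^sub>L T = T"
    using T(2) by (metis op_compose_assoc)
  obtain g where g: "is_onb n g (range P)" "image_orthogonal T n g"
    using rank_projection_singular_onb[OF P T(1)] .
  then have g_on: "orthonormal n g"
    by (simp add: is_onb_iff)
  define J where "J = {i. i < n \<and> \<epsilon> \<le> norm (T (g i))}"
  have J: "finite J" "J \<subseteq> {..<n}"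
    by (auto simp: J_def)
  obtain L where L: "finite L" "card L \<le> N" "\<forall>f\<in>L. linear_functional f"
    "\<And>x. \<forall>f\<in>L. f x = 0 \<Longrightarrow> norm (T x) \<le> \<delta> * norm x"
    using small by (auto simp: small_off_def)
  have "card L < card J"
    using contra L(2) num_outliers_range_mat[OF P(1) T(1) PT g, of \<epsilon>] by (simp add: J_def)
  then obtain c where c: "\<exists>i\<in>J. c i \<noteq> 0" "\<forall>f\<in>L. (\<Sum>i\<in>J. c i * f (g i)) = 0"
    using homogeneous_system_solvable[OF L(1) J(1), of "\<lambda>f i. f (g i)"] by blast
  define x where "x = (\<Sum>i\<in>J. c i *\<^sub>C g i)"
  have "norm (T x) \<le> \<delta> * norm x"
    using c(2) L(3) by (intro L(4)) (simp add: x_def linear_functional_sum)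
  then have "(norm (T x))\<^sup>2 \<le> \<delta>\<^sup>2 * (norm x)\<^sup>2"
    by (metis norm_ge_zero power_mono power_mult_distrib)
  moreover have "\<epsilon>\<^sup>2 * (norm x)\<^sup>2 \<le> (norm (T x))\<^sup>2"
    unfolding x_def orthonormal_norm_sq[OF g_on J(2)] image_orthogonal_norm_sq[OF T(1) g(2) J(2)] sum_distrib_left
  proof (rule sum_mono)
    fix i assume "i \<in> J"
    then have "\<epsilon>\<^sup>2 \<le> (norm (T (g i)))\<^sup>2"
      using assms(7,8) by (intro power_mono) (auto simp: J_def)
    then show "\<epsilon>\<^sup>2 * (cmod (c i))\<^sup>2 \<le> (cmod (c i))\<^sup>2 * (norm (T (g i)))\<^sup>2"
      unfolding mult.commute[of "\<epsilon>\<^sup>2"] by (rule mult_left_mono) simp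
  qed
  moreover have "\<delta>\<^sup>2 < \<epsilon>\<^sup>2"
    using assms(7,8) by (intro power_strict_mono) auto
  moreover have "0 < (norm x)\<^sup>2"
  proof -
    obtain i where "i \<in> J" "c i \<noteq> 0"
      using c(1) by blast
    then show ?thesis
      unfolding x_def orthonormal_norm_sq[OF g_on J(2)] using J(1) by (intro sum_pos2[of J i]) auto
  qed
  ultimately show False
    by (meson mult_less_cancel_right_pos not_less order_trans)
qed

section \<open>Negligible sequences of operators\<close>

text \<open>Strong and weak clusters differ only in which sequences are admitted as bounds on the number of outliers.
  The argument needs nothing but that these bounds can be added and that zero is one of them.\<close>

locale growth_class =
  fixes \<N> :: "(nat \<Rightarrow> nat) set"
  assumes zero_growth: "(\<lambda>_. 0) \<in> \<N>"
    and add_growth: "N \<in> \<N> \<Longrightarrow> M \<in> \<N> \<Longrightarrow> (\<lambda>n. N n + M n) \<in> \<N>"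
begin

definition cluster :: "(nat \<Rightarrow> complex mat) \<Rightarrow> (nat \<Rightarrow> complex mat) \<Rightarrow> bool" where
  "cluster X Y \<longleftrightarrow> (\<forall>\<epsilon>>0. \<exists>N\<in>\<N>. \<forall>\<^sub>F n in sequentially. num_outliers \<epsilon> (X n - Y n) \<le> N n)"

definition negligible :: "(nat \<Rightarrow> 'a::complex_hilbert_space operator) \<Rightarrow> bool" where
  "negligible X \<longleftrightarrow> (\<forall>\<epsilon>>0. \<exists>N\<in>\<N>. \<forall>\<^sub>F n in sequentially. small_off \<epsilon> (N n) (X n))"

lemma negligibleD:
  assumes "negligible X" "\<epsilon> > 0"
  obtains N where "N \<in> \<N>" "\<forall>\<^sub>F n in sequentially. small_off \<epsilon> (N n) (X n)"
  using assms by (auto simp: negligible_def)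

text \<open>For compressed operators the cluster condition on matrices is negligibility of the operators, which can be
  manipulated without reference to bases or singular values.\<close>

lemma cluster_iff_negligible:
  fixes P :: "nat \<Rightarrow> 'a::complex_hilbert_space operator"
  assumes P: "\<And>n. n \<ge> 1 \<Longrightarrow> orthogonal_projection (P n)" "\<And>n. n \<ge> 1 \<Longrightarrow> op_rank (P n) = n"
    and T: "\<And>n. n \<ge> 1 \<Longrightarrow> T n \<in> bounded_ops" "\<And>n. n \<ge> 1 \<Longrightarrow> P n o\<^sub>L T n o\<^sub>L P n = T n"
    and XY: "\<And>n. n \<ge> 1 \<Longrightarrow> X n - Y n = range_mat n (P n) (T n)"
  shows "cluster X Y \<longleftrightarrow> negligible T"
proof
  assume cl: "cluster X Y"
  show "negligible T"
    unfolding negligible_def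
  proof (intro allI impI)
    fix \<epsilon> :: real assume "\<epsilon> > 0"
    then obtain N where N: "N \<in> \<N>" "\<forall>\<^sub>F n in sequentially. num_outliers \<epsilon> (X n - Y n) \<le> N n"
      using cl by (auto simp: cluster_def)
    have "\<forall>\<^sub>F n in sequentially. small_off \<epsilon> (N n) (T n)"
      using N(2) eventually_ge_at_top[of 1]
    proof eventually_elim
      case (elim n)
      then show ?case
        using small_off_if_num_outliers[OF P(1)[OF elim(2)] P(2)[OF elim(2)] elim(2) T(1)[OF elim(2)] T(2)[OF elim(2)], of \<epsilon> "N n"] \<open>\<epsilon> > 0\<close> by (simp add: XY)
    qed
    with N(1) show "\<exists>N\<in>\<N>. \<forall>\<^sub>F n in sequentially. small_off \<epsilon> (N n) (T n)"
      by blast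
  qed
next
  assume neg: "negligible T"
  show "cluster X Y"
    unfolding cluster_def
  proof (intro allI impI)
    fix \<epsilon> :: real assume "\<epsilon> > 0"
    (* a singular value equal to the bound in the definition of smallness would be an outlier at that level *)
    then obtain N where N: "N \<in> \<N>" "\<forall>\<^sub>F n in sequentially. small_off (\<epsilon> / 2) (N n) (T n)"
      using negligibleD[OF neg, of "\<epsilon> / 2"] by auto
    have "\<forall>\<^sub>F n in sequentially. num_outliers \<epsilon> (X n - Y n) \<le> N n"
      using N(2) eventually_ge_at_top[of 1]
    proof eventually_elim
      case (elim n)
      then show ?case
        using num_outliers_if_small_off[OF P(1)[OF elim(2)] P(2)[OF elim(2)] elim(2) T(1)[OF elim(2)] T(2)[OF elim(2)] elim(1), of \<epsilon>] \<open>\<epsilon> > 0\<close> by (simp add: XY)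
    qed
    with N(1) show "\<exists>N\<in>\<N>. \<forall>\<^sub>F n in sequentially. num_outliers \<epsilon> (X n - Y n) \<le> N n"
      by blast
  qed
qed

lemma negligible_0: "negligible (\<lambda>_. 0)"
  unfolding negligible_def small_off_def by (force intro!: bexI[OF _ zero_growth])

lemma negligible_mono:
  fixes X Y :: "nat \<Rightarrow> 'a::complex_hilbert_space operator"
  assumes X: "negligible X" and K: "0 \<le> K"
    and le: "\<And>n x. n \<ge> 1 \<Longrightarrow> norm (Y n x) \<le> K * norm (X n x)"
  shows "negligible Y"
  unfolding negligible_def
proof (intro allI impI)
  fix \<epsilon> :: real assume \<epsilon>: "\<epsilon> > 0"
  then have "\<epsilon> / (K + 1) > 0"
    using K by simp
  then obtain N where N: "N \<in> \<N>" "\<forall>\<^sub>F n in sequentially. small_off (\<epsilon> / (K + 1)) (N n) (X n)"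
    using negligibleD[OF X] by blast
  have le_eps: "K * (\<epsilon> / (K + 1)) + 0 \<le> \<epsilon>"
    using K \<epsilon> by (simp add: field_simps)
  have "\<forall>\<^sub>F n in sequentially. small_off \<epsilon> (N n) (Y n)"
    using N(2) eventually_ge_at_top[of 1]
    by eventually_elim (rule small_off_mono[OF _ _ K le_eps], assumption, simp add: le)
  with N(1) show "\<exists>N\<in>\<N>. \<forall>\<^sub>F n in sequentially. small_off \<epsilon> (N n) (Y n)"
    by blast
qed

lemma negligible_cong:
  assumes "negligible X" "\<And>n. n \<ge> 1 \<Longrightarrow> Y n = X n"
  shows "negligible Y"
  by (rule negligible_mono[OF assms(1), of 1]) (simp_all add: assms(2))

lemma negligible_add:
  assumes "negligible X" "negligible Y"
  shows "negligible (\<lambda>n. X n + Y n)"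
  unfolding negligible_def
proof (intro allI impI)
  fix \<epsilon> :: real assume "\<epsilon> > 0"
  then have "\<epsilon> / 2 > 0"
    by simp
  obtain N where N: "N \<in> \<N>" "\<forall>\<^sub>F n in sequentially. small_off (\<epsilon> / 2) (N n) (X n)"
    using negligibleD[OF assms(1) \<open>\<epsilon> / 2 > 0\<close>] .
  obtain M where M: "M \<in> \<N>" "\<forall>\<^sub>F n in sequentially. small_off (\<epsilon> / 2) (M n) (Y n)"
    using negligibleD[OF assms(2) \<open>\<epsilon> / 2 > 0\<close>] .
  have "\<forall>\<^sub>F n in sequentially. small_off \<epsilon> (N n + M n) (X n + Y n)"
    using N(2) M(2)
  proof eventually_elim
    case (elim n)
    show ?case
      using small_off_add[OF elim] by simp
  qed
  with add_growth[OF N(1) M(1)] show "\<exists>N\<in>\<N>. \<forall>\<^sub>F n in sequentially. small_off \<epsilon> (N n) (X n + Y n)"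
    by (intro bexI[of _ "\<lambda>n. N n + M n"])
qed

lemma negligible_diff:
  assumes "negligible X" "negligible Y"
  shows "negligible (\<lambda>n. X n - Y n)"
proof -
  have "negligible (\<lambda>n. - Y n)"
    by (rule negligible_mono[OF assms(2), of 1]) (simp_all add: blinfun.minus_left)
  then show ?thesis
    using negligible_add[OF assms(1)] by fastforce
qed

lemma negligible_scaleC:
  assumes "negligible X"
  shows "negligible (\<lambda>n. scaleC_op c (X n))"
  by (rule negligible_mono[OF assms, of "cmod c"]) (simp_all add: scaleC_op.rep_eq norm_scaleC)

lemma negligible_compose_left:
  assumes "negligible X" "\<And>n. n \<ge> 1 \<Longrightarrow> norm (S n) \<le> K"
  shows "negligible (\<lambda>n. S n o\<^sub>L X n)"
proof (rule negligible_mono[OF assms(1)])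
  show "0 \<le> K"
    using assms(2)[of 1] norm_ge_zero[of "S 1"] by linarith
  show "norm ((S n o\<^sub>L X n) x) \<le> K * norm (X n x)" if "n \<ge> 1" for n x
    using assms(2)[OF that] by (auto intro!: order_trans[OF norm_blinfun] mult_right_mono)
qed

lemma negligible_compose_right:
  assumes X: "negligible X" and S: "\<And>n. n \<ge> 1 \<Longrightarrow> norm (S n) \<le> K" "\<And>n. n \<ge> 1 \<Longrightarrow> S n \<in> bounded_ops"
  shows "negligible (\<lambda>n. X n o\<^sub>L S n)"
  unfolding negligible_def
proof (intro allI impI)
  fix \<epsilon> :: real assume \<epsilon>: "\<epsilon> > 0"
  have K: "0 \<le> K"
    using S(1)[of 1] norm_ge_zero[of "S 1"] by linarith
  define \<delta> where "\<delta> = \<epsilon> / (K + 1)"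
  have \<delta>: "\<delta> > 0" "\<delta> * (K + 1) = \<epsilon>"
    using K \<epsilon> by (simp_all add: \<delta>_def)
  obtain N where N: "N \<in> \<N>" "\<forall>\<^sub>F n in sequentially. small_off \<delta> (N n) (X n)"
    using negligibleD[OF X \<delta>(1)] .
  have "\<forall>\<^sub>F n in sequentially. small_off \<epsilon> (N n) (X n o\<^sub>L S n)"
    using N(2) eventually_ge_at_top[of 1]
  proof eventually_elim
    case (elim n)
    have "norm (S n) \<le> K + 1"
      using S(1)[OF elim(2)] by simp
    then show ?case
      using small_off_compose_right[OF elim(1) S(2)[OF elim(2)], of "K + 1"] \<delta> by simp
  qed
  with N(1) show "\<exists>N\<in>\<N>. \<forall>\<^sub>F n in sequentially. small_off \<epsilon> (N n) (X n o\<^sub>L S n)"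
    by blast
qed

lemma negligible_limit:
  assumes "\<And>\<delta>. \<delta> > 0 \<Longrightarrow> \<exists>X. negligible X \<and> (\<forall>n\<ge>1. norm (Y n - X n) \<le> \<delta>)"
  shows "negligible Y"
  unfolding negligible_def
proof (intro allI impI)
  fix \<epsilon> :: real assume "\<epsilon> > 0"
  then have "\<epsilon> / 2 > 0"
    by simp
  obtain X where X: "negligible X" "\<And>n. n \<ge> 1 \<Longrightarrow> norm (Y n - X n) \<le> \<epsilon> / 2"
    using assms[OF \<open>\<epsilon> / 2 > 0\<close>] by blast
  obtain N where N: "N \<in> \<N>" "\<forall>\<^sub>F n in sequentially. small_off (\<epsilon> / 2) (N n) (X n)"
    using negligibleD[OF X(1) \<open>\<epsilon> / 2 > 0\<close>] .
  have "\<forall>\<^sub>F n in sequentially. small_off \<epsilon> (N n) (Y n)"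
    using N(2) eventually_ge_at_top[of 1]
  proof eventually_elim
    case (elim n)
    have "norm (Y n x) \<le> 1 * norm (X n x) + \<epsilon> / 2 * norm x" for x
    proof -
      have "norm (Y n x) \<le> norm (X n x) + norm ((Y n - X n) x)"
        using norm_triangle_ineq[of "X n x" "(Y n - X n) x"] by (simp add: blinfun.diff_left)
      also have "norm ((Y n - X n) x) \<le> \<epsilon> / 2 * norm x"
        using X(2)[OF elim(2)] by (intro order_trans[OF norm_blinfun] mult_right_mono) auto
      finally show ?thesis
        by simp
    qed
    then show ?case
      by (rule small_off_mono[OF elim(1)]) auto
  qed
  with N(1) show "\<exists>N\<in>\<N>. \<forall>\<^sub>F n in sequentially. small_off \<epsilon> (N n) (Y n)"
    by blast
qed

text \<open>The Schwarz inequality controls only the square of the norm of a multiplicative defect. Negligibility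
  survives this because the level \<open>\<epsilon>\<close> is arbitrary: smallness of \<open>X\<close> at level \<open>\<epsilon>\<^sup>2 / (K + 1)\<close> suffices.\<close>

lemma negligible_sqrt:
  fixes X Y :: "nat \<Rightarrow> 'a::complex_hilbert_space operator"
  assumes X: "negligible X" and K: "0 \<le> K"
    and le: "\<And>n x. n \<ge> 1 \<Longrightarrow> (norm (Y n x))\<^sup>2 \<le> K * norm (X n x) * norm x"
  shows "negligible Y"
  unfolding negligible_def
proof (intro allI impI)
  fix \<epsilon> :: real assume \<epsilon>: "\<epsilon> > 0"
  define \<delta> where "\<delta> = \<epsilon>\<^sup>2 / (K + 1)"
  have \<delta>: "\<delta> > 0" "K * \<delta> \<le> \<epsilon>\<^sup>2"
    using K \<epsilon> by (simp_all add: \<delta>_def field_simps)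
  obtain N where N: "N \<in> \<N>" "\<forall>\<^sub>F n in sequentially. small_off \<delta> (N n) (X n)"
    using negligibleD[OF X \<delta>(1)] .
  have "\<forall>\<^sub>F n in sequentially. small_off \<epsilon> (N n) (Y n)"
    using N(2) eventually_ge_at_top[of 1]
  proof eventually_elim
    case (elim n)
    have "norm (Y n x) \<le> \<epsilon> * norm x" if "norm (X n x) \<le> \<delta> * norm x" for x
    proof (rule power2_le_imp_le)
      have "(norm (Y n x))\<^sup>2 \<le> K * norm (X n x) * norm x"
        by (rule le[OF elim(2)])
      also have "\<dots> \<le> K * (\<delta> * norm x) * norm x"
        using that K by (intro mult_right_mono mult_left_mono) auto
      also have "\<dots> = K * \<delta> * (norm x)\<^sup>2"
        by (simp add: power2_eq_square)
      also have "\<dots> \<le> \<epsilon>\<^sup>2 * (norm x)\<^sup>2"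
        using \<delta>(2) by (intro mult_right_mono) auto
      finally show "(norm (Y n x))\<^sup>2 \<le> (\<epsilon> * norm x)\<^sup>2"
        by (simp add: power_mult_distrib)
    qed (use \<epsilon> in simp)
    then show ?case
      using elim(1) unfolding small_off_def by meson
  qed
  with N(1) show "\<exists>N\<in>\<N>. \<forall>\<^sub>F n in sequentially. small_off \<epsilon> (N n) (Y n)"
    by blast
qed

end

section \<open>The Schwarz inequality for completely positive contractions\<close>

lemma cp_linear: "completely_positive \<Phi> \<Longrightarrow> linear_op_map \<Phi>"
  by (simp add: completely_positive_def)

lemma
  assumes "linear_op_map \<Phi>"
  shows linear_op_map_mem: "T \<in> bounded_ops \<Longrightarrow> \<Phi> T \<in> bounded_ops"
    and linear_op_map_add: "S \<in> bounded_ops \<Longrightarrow> T \<in> bounded_ops \<Longrightarrow> \<Phi> (S + T) = \<Phi> S + \<Phi> T"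
    and linear_op_map_scaleC: "T \<in> bounded_ops \<Longrightarrow> \<Phi> (scaleC_op c T) = scaleC_op c (\<Phi> T)"
  using assms by (auto simp: linear_op_map_def)

lemma linear_op_map_diff:
  assumes "linear_op_map \<Phi>" "S \<in> bounded_ops" "T \<in> bounded_ops"
  shows "\<Phi> (S - T) = \<Phi> S - \<Phi> T"
  using linear_op_map_add[OF assms(1,2) bounded_ops_scaleC[OF assms(3), of "- 1"]]
    linear_op_map_scaleC[OF assms(1,3), of "- 1"]
  by (simp add: scaleC_op_minus1)

lemma linear_op_map_0: "linear_op_map \<Phi> \<Longrightarrow> \<Phi> 0 = 0"
  using linear_op_map_diff[of \<Phi> 0 0] bounded_ops_0 by simp

lemma completely_positive_id: "completely_positive (\<lambda>T. T)"
  by (simp add: completely_positive_def linear_op_map_def)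

lemma completely_positive_compress:
  assumes "completely_positive \<Phi>" and P: "is_adjoint P P"
  shows "completely_positive (\<lambda>T. P o\<^sub>L \<Phi> T o\<^sub>L P)"
  unfolding completely_positive_def linear_op_map_def
proof (intro conjI ballI allI impI)
  have P_mem: "P \<in> bounded_ops"
    using P by (simp add: is_adjoint_def)
  note lin = cp_linear[OF assms(1)]
  fix S T :: "'a operator" and c assume S: "S \<in> bounded_ops" and T: "T \<in> bounded_ops"
  show "P o\<^sub>L \<Phi> T o\<^sub>L P \<in> bounded_ops"
    using T P_mem by (simp add: bounded_ops_compose linear_op_map_mem[OF lin])
  show "P o\<^sub>L \<Phi> (S + T) o\<^sub>L P = (P o\<^sub>L \<Phi> S o\<^sub>L P) + (P o\<^sub>L \<Phi> T o\<^sub>L P)"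
    by (rule blinfun_eqI) (simp add: linear_op_map_add[OF lin S T] blinfun.add_left blinfun.add_right)
  show "P o\<^sub>L \<Phi> (scaleC_op c T) o\<^sub>L P = scaleC_op c (P o\<^sub>L \<Phi> T o\<^sub>L P)"
    by (rule blinfun_eqI) (simp add: linear_op_map_scaleC[OF lin T] scaleC_op.rep_eq bounded_opsD[OF P_mem])
next
  fix k and T :: "nat \<Rightarrow> nat \<Rightarrow> 'a operator"
  assume "(\<forall>i<k. \<forall>j<k. T i j \<in> bounded_ops) \<and> positive_op_matrix k T"
  then have pos: "positive_op_matrix k (\<lambda>i j. \<Phi> (T i j))"
    using assms(1) by (simp add: completely_positive_def)
  show "positive_op_matrix k (\<lambda>i j. P o\<^sub>L \<Phi> (T i j) o\<^sub>L P)"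
    unfolding positive_op_matrix_def
  proof
    fix x :: "nat \<Rightarrow> 'a"
    show "0 \<le> (\<Sum>i<k. \<Sum>j<k. cinner ((P o\<^sub>L \<Phi> (T i j) o\<^sub>L P) (x j)) (x i))"
      using pos[unfolded positive_op_matrix_def, rule_format, of "\<lambda>i. P (x i)"] by (simp add: is_adjointD[OF P])
  qed
qed

lemma contractive_compress:
  assumes "contractive \<Phi>" "norm P \<le> 1"
  shows "contractive (\<lambda>T. P o\<^sub>L \<Phi> T o\<^sub>L P)"
  unfolding contractive_def
proof
  fix T :: "'a operator" assume T: "T \<in> bounded_ops"
  have "norm (P o\<^sub>L \<Phi> T o\<^sub>L P) \<le> norm P * norm (\<Phi> T) * norm P"
    by (intro order_trans[OF norm_blinfun_compose] mult_right_mono norm_blinfun_compose) simp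
  also have "\<dots> \<le> 1 * norm (\<Phi> T) * 1"
    using assms(2) by (intro mult_mono) auto
  also have "\<dots> \<le> norm T"
    using assms(1) T by (simp add: contractive_def)
  finally show "norm (P o\<^sub>L \<Phi> T o\<^sub>L P) \<le> norm T" .
qed

lemma contractive_id: "contractive (\<lambda>T. T)"
  by (simp add: contractive_def)

lemma contractiveD: "contractive \<Phi> \<Longrightarrow> T \<in> bounded_ops \<Longrightarrow> norm (\<Phi> T) \<le> norm T"
  by (simp add: contractive_def)

lemma positive_gram_matrix:
  fixes G G' :: "nat \<Rightarrow> 'a::complex_hilbert_space operator"
  assumes "\<And>i. i < k \<Longrightarrow> is_adjoint (G i) (G' i)"
  shows "positive_op_matrix k (\<lambda>i j. G' i o\<^sub>L G j)"
  unfolding positive_op_matrix_def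
proof
  fix x :: "nat \<Rightarrow> 'a"
  let ?z = "\<Sum>i<k. G i (x i)"
  have "(\<Sum>i<k. \<Sum>j<k. cinner ((G' i o\<^sub>L G j) (x j)) (x i)) = (\<Sum>i<k. \<Sum>j<k. cinner (G j (x j)) (G i (x i)))"
    using is_adjointD'[OF assms] by (intro sum.cong refl) simp
  also have "\<dots> = cinner ?z ?z"
    unfolding cinner_sum_left cinner_sum_right ..
  finally show "0 \<le> (\<Sum>i<k. \<Sum>j<k. cinner ((G' i o\<^sub>L G j) (x j)) (x i))"
    by (simp add: cinner_self less_eq_complex_def)
qed

lemma cp_gram_matrix:
  fixes k :: nat
  assumes "completely_positive \<Phi>" "\<And>i. i < k \<Longrightarrow> is_adjoint (G i) (G' i)"
  shows "0 \<le> (\<Sum>i<k. \<Sum>j<k. cinner (\<Phi> (G' i o\<^sub>L G j) (x j)) (x i))"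
proof -
  have "\<forall>i<k. \<forall>j<k. G' i o\<^sub>L G j \<in> bounded_ops"
    using assms(2) by (simp add: is_adjoint_def bounded_ops_compose)
  then have "positive_op_matrix k (\<lambda>i j. \<Phi> (G' i o\<^sub>L G j))"
    using assms(1)[unfolded completely_positive_def, THEN conjunct2, rule_format, of k "\<lambda>i j. G' i o\<^sub>L G j"]
      positive_gram_matrix[of k G G', OF assms(2)] by blast
  then show ?thesis
    by (simp add: positive_op_matrix_def)
qed

text \<open>The Gram matrix of \<open>1\<close> and \<open>T\<close> has the off-diagonal entries \<open>T\<close> and \<open>T\<^sup>*\<close>. Its image under the map is a positive
  form, which is real on the diagonal and hence Hermitian.\<close>

lemma cp_is_adjoint:
  fixes T T' :: "'a::complex_hilbert_space operator"
  assumes cp: "completely_positive \<Phi>" and adj: "is_adjoint T T'"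
  shows "is_adjoint (\<Phi> T) (\<Phi> T')"
proof -
  define G where "G i = (if i = (0::nat) then id_blinfun else T)" for i
  define G' where "G' i = (if i = (0::nat) then id_blinfun else T')" for i
  define f where "f x = (\<Sum>i<2. \<Sum>j<2. cinner (\<Phi> (G' i o\<^sub>L G j) (x j)) (x i))" for x :: "nat \<Rightarrow> 'a"
  have T_mem: "T \<in> bounded_ops" "T' \<in> bounded_ops"
    using adj by (auto simp: is_adjoint_def)
  have "is_adjoint (G i) (G' i)" for i
    using adj by (simp add: is_adjoint_id G_def G'_def)
  then have "0 \<le> f x" for x
    unfolding f_def by (intro cp_gram_matrix[OF cp])
  then have im: "Im (f x) = 0" for x
    using less_eq_complex_def by (metis zero_complex.sel(2))
  have f_eq: "f (\<lambda>i. if i = 0 then y else x) =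
      cinner (\<Phi> id_blinfun y) y + cinner (\<Phi> T x) y + cinner (\<Phi> T' y) x + cinner (\<Phi> (T' o\<^sub>L T) x) x" for x y
    by (simp add: f_def G_def G'_def numeral_2_eq_2 lessThan_Suc)
  (* the choices x = 0 and y = 0 show that the diagonal terms are real *)
  have cross: "Im (cinner (\<Phi> T x) y) = - Im (cinner (\<Phi> T' y) x)" for x y
    using im[of "\<lambda>i. if i = 0 then y else x"] im[of "\<lambda>i. if i = 0 then y else 0"] im[of "\<lambda>i. if i = 0 then 0 else x"]
    unfolding f_eq by (simp add: blinfun.zero_right)
  have "cinner (\<Phi> T x) y = cnj (cinner (\<Phi> T' y) x)" for x y
  proof -
    (* replacing x by i x turns imaginary parts into real parts *)
    have "Im (\<i> * cinner (\<Phi> T x) y) = - Im (- (\<i> * cinner (\<Phi> T' y) x))"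
      using cross[of "\<i> *\<^sub>C x" y] linear_op_map_mem[OF cp_linear[OF cp] T_mem(1)]
      by (simp add: bounded_opsD cinner_scaleC_left cinner_scaleC_right)
    then show ?thesis
      using cross[of x y] by (simp add: complex_eq_iff)
  qed
  then show ?thesis
    using linear_op_map_mem[OF cp_linear[OF cp]] T_mem unfolding is_adjoint_def
    by (simp flip: cinner_commute)
qed

text \<open>Applying the map to the Gram matrix of \<open>1\<close>, \<open>S\<^sup>*\<close>, \<open>T\<close> and evaluating at the vector
  \<open>(- \<Phi>(S\<^sup>*) y - \<Phi>(T) x, y, x)\<close> gives, since \<open>\<Phi>(1) \<le> 1\<close>, a positive form in \<open>(y, x)\<close> whose off-diagonal entry is the
  multiplicative defect of the pair \<open>(S, T)\<close> and whose diagonal entries are the Schwarz defects. The one that belongs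
  to \<open>S\<close> is at most \<open>\<parallel>S\<parallel>\<^sup>2\<close>, so the defect of the pair is
  dominated by the Schwarz defect of \<open>T\<close>.\<close>

lemma schwarz_defect_bound:
  fixes S S' T T' :: "'a::complex_hilbert_space operator"
  assumes cp: "completely_positive \<Phi>" and contr: "contractive \<Phi>"
    and S: "is_adjoint S S'" and T: "is_adjoint T T'"
  shows "(norm ((\<Phi> (S o\<^sub>L T) - (\<Phi> S o\<^sub>L \<Phi> T)) x))\<^sup>2
    \<le> ((norm S)\<^sup>2 + 1) * norm ((\<Phi> (T' o\<^sub>L T) - (\<Phi> T' o\<^sub>L \<Phi> T)) x) * norm x"
proof -
  define K where "K = (norm S)\<^sup>2 + 1"
  define d where "d = (\<Phi> (S o\<^sub>L T) - (\<Phi> S o\<^sub>L \<Phi> T)) x"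
  define E where "E = \<Phi> (T' o\<^sub>L T) - (\<Phi> T' o\<^sub>L \<Phi> T)"
  have mem: "S \<in> bounded_ops" "S' \<in> bounded_ops" "T \<in> bounded_ops" "T' \<in> bounded_ops"
    using S T by (auto simp: is_adjoint_def)
  note \<Phi>S = cp_is_adjoint[OF cp S] and \<Phi>T = cp_is_adjoint[OF cp T]
  have \<Phi>ST: "is_adjoint (\<Phi> (S o\<^sub>L T)) (\<Phi> (T' o\<^sub>L S'))"
    using cp_is_adjoint[OF cp is_adjoint_compose[OF S T]] .
  have main: "0 \<le> K * (norm y)\<^sup>2 + Re (cinner (E x) x) + 2 * Re (cinner d y)" for y
  proof -
    define a where "a = \<Phi> S' y"
    define b where "b = \<Phi> T x"
    define G where "G i = (if i = 0 then id_blinfun else if i = Suc 0 then S' else T)" for i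
    define G' where "G' i = (if i = 0 then id_blinfun else if i = Suc 0 then S else T')" for i
    define v where "v i = (if i = 0 then - (a + b) else if i = Suc 0 then y else x)" for i
    have "is_adjoint (G i) (G' i)" for i
      using is_adjoint_sym[OF S] T by (simp add: is_adjoint_id G_def G'_def)
    then have "0 \<le> (\<Sum>i<3. \<Sum>j<3. cinner (\<Phi> (G' i o\<^sub>L G j) (v j)) (v i))"
      by (intro cp_gram_matrix[OF cp])
    then have "0 \<le> Re (\<Sum>i<3. \<Sum>j<3. cinner (\<Phi> (G' i o\<^sub>L G j) (v j)) (v i))"
      by (simp add: less_eq_complex_def)
    also have "\<dots> = Re (cinner (\<Phi> id_blinfun (a + b)) (a + b))
        - Re (cinner a (a + b)) - Re (cinner b (a + b))
        - Re (cinner (\<Phi> S (a + b)) y) + Re (cinner (\<Phi> (S o\<^sub>L S') y) y) + Re (cinner (\<Phi> (S o\<^sub>L T) x) y)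
        - Re (cinner (\<Phi> T' (a + b)) x) + Re (cinner (\<Phi> (T' o\<^sub>L S') y) x) + Re (cinner (\<Phi> (T' o\<^sub>L T) x) x)"
      by (simp add: G_def G'_def v_def numeral_3_eq_3 lessThan_Suc a_def b_def
          blinfun.minus_right blinfun.diff_right cinner_minus_left cinner_minus_right cinner_diff_right cinner_diff_left
          blinfun.add_right cinner_add_left cinner_add_right)
    finally have pos: "0 \<le> \<dots>" .
    have one: "Re (cinner (\<Phi> id_blinfun (a + b)) (a + b)) \<le> (norm (a + b))\<^sup>2"
    proof -
      have "Re (cinner (\<Phi> id_blinfun (a + b)) (a + b)) \<le> norm (\<Phi> id_blinfun (a + b)) * norm (a + b)"
        by (rule Re_cinner_le)
      also have "norm (\<Phi> id_blinfun (a + b)) \<le> norm (\<Phi> id_blinfun) * norm (a + b)"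
        by (rule norm_blinfun)
      also have "norm (\<Phi> id_blinfun) \<le> 1"
        using contractiveD[OF contr bounded_ops_id] norm_blinfun_id_le by (rule order_trans)
      finally show ?thesis
        by (simp add: power2_eq_square mult_right_mono)
    qed
    have bound_S: "Re (cinner (\<Phi> (S o\<^sub>L S') y) y) \<le> K * (norm y)\<^sup>2"
    proof -
      have "norm (\<Phi> (S o\<^sub>L S')) \<le> norm (S o\<^sub>L S')"
        using contractiveD[OF contr bounded_ops_compose[OF mem(1,2)]] .
      also have "\<dots> \<le> norm S * norm S'"
        by (rule norm_blinfun_compose)
      also have "\<dots> \<le> K"
        using norm_is_adjoint[OF S] by (simp add: K_def power2_eq_square)
      finally have K: "norm (\<Phi> (S o\<^sub>L S')) \<le> K" .
      have "Re (cinner (\<Phi> (S o\<^sub>L S') y) y) \<le> norm (\<Phi> (S o\<^sub>L S') y) * norm y"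
        by (rule Re_cinner_le)
      also have "\<dots> \<le> (K * norm y) * norm y"
        using K by (intro mult_right_mono order_trans[OF norm_blinfun]) auto
      finally show ?thesis
        by (simp add: power2_eq_square mult.assoc)
    qed
    have "Re (cinner (\<Phi> S (a + b)) y) = Re (cinner (a + b) a)"
      using is_adjointD[OF \<Phi>S] by (simp add: a_def)
    moreover have "Re (cinner (\<Phi> T' (a + b)) x) = Re (cinner (a + b) b)"
      using is_adjointD'[OF \<Phi>T] by (simp add: b_def)
    moreover have "Re (cinner (\<Phi> (T' o\<^sub>L S') y) x) = Re (cinner (\<Phi> (S o\<^sub>L T) x) y)"
      using is_adjointD'[OF \<Phi>ST] Re_cinner_commute by metis
    moreover have "Re (cinner d y) = Re (cinner (\<Phi> (S o\<^sub>L T) x) y) - Re (cinner b a)"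
      using is_adjointD[OF \<Phi>S] by (simp add: d_def blinfun.diff_left cinner_diff_left a_def b_def)
    moreover have "Re (cinner (E x) x) = Re (cinner (\<Phi> (T' o\<^sub>L T) x) x) - (norm b)\<^sup>2"
      using is_adjointD'[OF \<Phi>T] by (simp add: E_def blinfun.diff_left cinner_diff_left b_def cinner_self)
    moreover have "Re (cinner (a + b) (a + b)) = (norm (a + b))\<^sup>2"
      by (simp add: cinner_self)
    then have "Re (cinner a (a + b)) + Re (cinner b (a + b)) = (norm (a + b))\<^sup>2"
      "Re (cinner (a + b) a) + Re (cinner (a + b) b) = (norm (a + b))\<^sup>2"
      by (simp_all add: cinner_add_left cinner_add_right)
    moreover have "(norm (a + b))\<^sup>2 = (norm a)\<^sup>2 + (norm b)\<^sup>2 + 2 * Re (cinner b a)"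
      using norm_add_sq[of a b] Re_cinner_commute[of a b] by simp
    moreover have "0 \<le> (norm a)\<^sup>2"
      by simp
    ultimately show ?thesis
      using pos one bound_S by argo
  qed
  (* y = - t d with this t minimises the right-hand side of the inequality above *)
  define t where "t = 1 / K"
  have K: "K > 0"
    by (simp add: K_def add_nonneg_pos)
  have scale: "cinner d (t *\<^sub>R d) = complex_of_real (t * (norm d)\<^sup>2)"
    by (simp add: cinner_scaleC_right cinner_self flip: scaleC_of_real)
  have "0 \<le> K * (norm (- (t *\<^sub>R d)))\<^sup>2 + Re (cinner (E x) x) + 2 * Re (cinner d (- (t *\<^sub>R d)))"
    by (rule main)
  also have "\<dots> = K * t\<^sup>2 * (norm d)\<^sup>2 + Re (cinner (E x) x) - 2 * t * (norm d)\<^sup>2"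
    by (simp add: cinner_minus_right scale power_mult_distrib)
  also have "\<dots> = Re (cinner (E x) x) - (norm d)\<^sup>2 / K"
    using K by (simp add: t_def power2_eq_square field_simps)
  finally have "(norm d)\<^sup>2 \<le> K * Re (cinner (E x) x)"
    using K by (simp add: field_simps)
  also have "\<dots> \<le> K * (norm (E x) * norm x)"
    using K by (intro mult_left_mono Re_cinner_le) simp
  finally show ?thesis
    by (simp add: K_def d_def E_def mult.assoc)
qed

section \<open>Asymptotic multiplicative domains\<close>

lemmas compose_add_right = bounded_bilinear.add_right[OF bounded_bilinear_blinfun_compose]
lemmas compose_diff_left = bounded_bilinear.diff_left[OF bounded_bilinear_blinfun_compose]
lemmas compose_diff_right = bounded_bilinear.diff_right[OF bounded_bilinear_blinfun_compose]

lemma compose_scaleC_right: "S \<in> bounded_ops \<Longrightarrow> S o\<^sub>L scaleC_op c T = scaleC_op c (S o\<^sub>L T)"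
  by (rule blinfun_eqI) (simp add: scaleC_op.rep_eq bounded_opsD)

lemma scaleC_op_diff: "scaleC_op c (S - T) = scaleC_op c S - scaleC_op c (T :: 'a::complex_hilbert_space operator)"
  by (rule blinfun_eqI) (simp add: scaleC_op.rep_eq blinfun.diff_left complex_vector.scale_right_diff_distrib)

locale cp_contractions = growth_class \<N> for \<N> :: "(nat \<Rightarrow> nat) set" +
  fixes \<Theta> :: "nat \<Rightarrow> 'a::complex_hilbert_space operator \<Rightarrow> 'a operator"
  assumes cp: "n \<ge> 1 \<Longrightarrow> completely_positive (\<Theta> n)"
    and contr: "n \<ge> 1 \<Longrightarrow> contractive (\<Theta> n)"
begin

text \<open>The multiplicative domain is defined by the products \<open>S T\<close> and not by the Schwarz defect of \<open>T\<close>, because the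
  former condition is linear in \<open>T\<close> and passes to products and limits at once. The operators \<open>S\<close> are those with an
  adjoint, as the Schwarz inequality involves \<open>S\<^sup>*\<close>.\<close>

definition mult_domain :: "'a operator set" where
  "mult_domain = {T \<in> bounded_ops. \<forall>S S'. is_adjoint S S' \<longrightarrow>
     negligible (\<lambda>n. \<Theta> n (S o\<^sub>L T) - (\<Theta> n S o\<^sub>L \<Theta> n T))}"

lemma lin: "n \<ge> 1 \<Longrightarrow> linear_op_map (\<Theta> n)"
  using cp cp_linear by blast

lemma mult_domain_mem: "T \<in> mult_domain \<Longrightarrow> T \<in> bounded_ops"
  by (simp add: mult_domain_def)

lemma mult_domainD:
  "T \<in> mult_domain \<Longrightarrow> is_adjoint S S' \<Longrightarrow> negligible (\<lambda>n. \<Theta> n (S o\<^sub>L T) - (\<Theta> n S o\<^sub>L \<Theta> n T))"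
  by (auto simp: mult_domain_def)

text \<open>For a self-adjoint \<open>A\<close> the Schwarz defect is \<open>\<Theta>(A\<^sup>2) - \<Theta>(A)\<^sup>2\<close>, and it dominates the defects of all pairs \<open>(S, A)\<close>.\<close>

lemma mult_domain_square:
  assumes "self_adjoint A" and "negligible (\<lambda>n. \<Theta> n (A o\<^sub>L A) - (\<Theta> n A o\<^sub>L \<Theta> n A))"
  shows "A \<in> mult_domain"
proof -
  have A: "is_adjoint A A" "A \<in> bounded_ops"
    using assms(1) by (auto simp: self_adjoint_def is_adjoint_def)
  have "negligible (\<lambda>n. \<Theta> n (S o\<^sub>L A) - (\<Theta> n S o\<^sub>L \<Theta> n A))" if S: "is_adjoint S S'" for S S'
    by (rule negligible_sqrt[OF assms(2), of "(norm S)\<^sup>2 + 1"])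
      (use schwarz_defect_bound[OF cp contr S A(1)] in auto)
  then show ?thesis
    using A(2) by (auto simp: mult_domain_def)
qed

lemma mult_domain_0: "0 \<in> mult_domain"
proof -
  have "negligible (\<lambda>n. \<Theta> n (S o\<^sub>L 0) - (\<Theta> n S o\<^sub>L \<Theta> n 0))" for S
    by (rule negligible_cong[OF negligible_0])
      (simp add: linear_op_map_0[OF lin] bounded_bilinear.zero_right[OF bounded_bilinear_blinfun_compose])
  then show ?thesis
    by (simp add: mult_domain_def bounded_ops_0)
qed

lemma mult_domain_add:
  assumes T: "T1 \<in> mult_domain" "T2 \<in> mult_domain"
  shows "T1 + T2 \<in> mult_domain"
proof -
  have "negligible (\<lambda>n. \<Theta> n (S o\<^sub>L (T1 + T2)) - (\<Theta> n S o\<^sub>L \<Theta> n (T1 + T2)))" if S: "is_adjoint S S'" for S S'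
  proof (rule negligible_cong[OF negligible_add[OF T[THEN mult_domainD, OF S]]])
    fix n :: nat assume n: "n \<ge> 1"
    have "S \<in> bounded_ops"
      using S by (simp add: is_adjoint_def)
    then show "\<Theta> n (S o\<^sub>L (T1 + T2)) - (\<Theta> n S o\<^sub>L \<Theta> n (T1 + T2)) =
        (\<Theta> n (S o\<^sub>L T1) - (\<Theta> n S o\<^sub>L \<Theta> n T1)) + (\<Theta> n (S o\<^sub>L T2) - (\<Theta> n S o\<^sub>L \<Theta> n T2))"
      using T[THEN mult_domain_mem]
      by (simp add: compose_add_right linear_op_map_add[OF lin[OF n]] bounded_ops_compose)
  qed
  then show ?thesis
    using T[THEN mult_domain_mem] by (auto simp: mult_domain_def bounded_ops_add)
qed

lemma mult_domain_scaleC: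
  assumes T: "T \<in> mult_domain"
  shows "scaleC_op c T \<in> mult_domain"
proof -
  have "negligible (\<lambda>n. \<Theta> n (S o\<^sub>L scaleC_op c T) - (\<Theta> n S o\<^sub>L \<Theta> n (scaleC_op c T)))" if S: "is_adjoint S S'" for S S'
  proof (rule negligible_cong[OF negligible_scaleC[OF mult_domainD[OF T S], of c]])
    fix n :: nat assume n: "n \<ge> 1"
    have "S \<in> bounded_ops"
      using S by (simp add: is_adjoint_def)
    then show "\<Theta> n (S o\<^sub>L scaleC_op c T) - (\<Theta> n S o\<^sub>L \<Theta> n (scaleC_op c T)) =
        scaleC_op c (\<Theta> n (S o\<^sub>L T) - (\<Theta> n S o\<^sub>L \<Theta> n T))"
      using mult_domain_mem[OF T] linear_op_map_mem[OF lin[OF n]]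
      by (simp add: compose_scaleC_right linear_op_map_scaleC[OF lin[OF n]] bounded_ops_compose scaleC_op_diff)
  qed
  then show ?thesis
    using mult_domain_mem[OF T] by (auto simp: mult_domain_def bounded_ops_scaleC)
qed

text \<open>\<open>\<Theta>(S T\<^sub>1 T\<^sub>2) \<approx> \<Theta>(S T\<^sub>1) \<Theta>(T\<^sub>2) \<approx> \<Theta>(S) \<Theta>(T\<^sub>1) \<Theta>(T\<^sub>2) \<approx> \<Theta>(S) \<Theta>(T\<^sub>1 T\<^sub>2)\<close>.\<close>

lemma mult_domain_compose:
  assumes T: "T1 \<in> mult_domain" "T2 \<in> mult_domain" and adj: "is_adjoint T1 T1'"
  shows "T1 o\<^sub>L T2 \<in> mult_domain"
proof -
  have "negligible (\<lambda>n. \<Theta> n (S o\<^sub>L (T1 o\<^sub>L T2)) - (\<Theta> n S o\<^sub>L \<Theta> n (T1 o\<^sub>L T2)))" if S: "is_adjoint S S'" for S S'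
  proof -
    have mem: "S \<in> bounded_ops"
      using S by (simp add: is_adjoint_def)
    have 1: "negligible (\<lambda>n. \<Theta> n ((S o\<^sub>L T1) o\<^sub>L T2) - (\<Theta> n (S o\<^sub>L T1) o\<^sub>L \<Theta> n T2))"
      by (rule mult_domainD[OF T(2) is_adjoint_compose[OF S adj]])
    have 2: "negligible (\<lambda>n. (\<Theta> n (S o\<^sub>L T1) - (\<Theta> n S o\<^sub>L \<Theta> n T1)) o\<^sub>L \<Theta> n T2)"
      using contractiveD[OF contr mult_domain_mem[OF T(2)]] linear_op_map_mem[OF lin mult_domain_mem[OF T(2)]]
      by (intro negligible_compose_right[OF mult_domainD[OF T(1) S], where K = "norm T2"])
    have 3: "negligible (\<lambda>n. \<Theta> n S o\<^sub>L (\<Theta> n (T1 o\<^sub>L T2) - (\<Theta> n T1 o\<^sub>L \<Theta> n T2)))"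
      using contractiveD[OF contr mem]
      by (intro negligible_compose_left[OF mult_domainD[OF T(2) adj], where K = "norm S"])
    show ?thesis
      by (rule negligible_cong[OF negligible_diff[OF negligible_add[OF 1 2] 3]])
        (simp add: compose_diff_left compose_diff_right op_compose_assoc)
  qed
  then show ?thesis
    using T[THEN mult_domain_mem] by (auto simp: mult_domain_def bounded_ops_compose)
qed

lemma mult_domain_limit:
  assumes T: "\<And>k. X k \<in> mult_domain" and lim: "X \<longlonglongrightarrow> T" and T_mem: "T \<in> bounded_ops"
  shows "T \<in> mult_domain"
proof -
  have "negligible (\<lambda>n. \<Theta> n (S o\<^sub>L T) - (\<Theta> n S o\<^sub>L \<Theta> n T))" if S: "is_adjoint S S'" for S S'
  proof (rule negligible_limit)
    fix \<delta> :: real assume "\<delta> > 0"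
    (* both terms of the defect of S and T - X k are at most norm S * norm (T - X k) *)
    define \<eta> where "\<eta> = \<delta> / (2 * (norm S + 1))"
    have nS: "norm S + 1 > 0"
      by (simp add: add_nonneg_pos)
    have \<eta>: "\<eta> > 0" "2 * (norm S + 1) * \<eta> = \<delta>"
      using nS \<open>\<delta> > 0\<close> by (simp_all add: \<eta>_def)
    obtain k where k: "norm (T - X k) < \<eta>"
      using LIMSEQ_D[OF lim \<eta>(1)] by (metis norm_minus_commute order_refl)
    have mem: "S \<in> bounded_ops" "X k \<in> bounded_ops" "T - X k \<in> bounded_ops"
      using S mult_domain_mem[OF T] T_mem by (auto simp: is_adjoint_def bounded_ops_diff)
    have "norm ((\<Theta> n (S o\<^sub>L T) - (\<Theta> n S o\<^sub>L \<Theta> n T)) - (\<Theta> n (S o\<^sub>L X k) - (\<Theta> n S o\<^sub>L \<Theta> n (X k)))) \<le> \<delta>"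
      if n: "n \<ge> 1" for n
    proof -
      have "(\<Theta> n (S o\<^sub>L T) - (\<Theta> n S o\<^sub>L \<Theta> n T)) - (\<Theta> n (S o\<^sub>L X k) - (\<Theta> n S o\<^sub>L \<Theta> n (X k))) =
          \<Theta> n (S o\<^sub>L (T - X k)) - (\<Theta> n S o\<^sub>L \<Theta> n (T - X k))"
        using mem T_mem by (simp add: compose_diff_right linear_op_map_diff[OF lin[OF n]] bounded_ops_compose)
      also have "norm \<dots> \<le> norm (\<Theta> n (S o\<^sub>L (T - X k))) + norm (\<Theta> n S o\<^sub>L \<Theta> n (T - X k))"
        by (rule norm_triangle_ineq4)
      also have "\<dots> \<le> norm S * norm (T - X k) + norm S * norm (T - X k)"
      proof (rule add_mono)
        show "norm (\<Theta> n (S o\<^sub>L (T - X k))) \<le> norm S * norm (T - X k)"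
          using contractiveD[OF contr[OF n] bounded_ops_compose[OF mem(1,3)]] norm_blinfun_compose
          by (rule order_trans)
        show "norm (\<Theta> n S o\<^sub>L \<Theta> n (T - X k)) \<le> norm S * norm (T - X k)"
          using contractiveD[OF contr[OF n]] mem
          by (intro order_trans[OF norm_blinfun_compose] mult_mono) auto
      qed
      also have "\<dots> \<le> 2 * (norm S + 1) * \<eta>"
      proof -
        have "norm S * norm (T - X k) \<le> (norm S + 1) * \<eta>"
          using k by (intro mult_mono) auto
        then show ?thesis
          by (simp add: algebra_simps)
      qed
      finally show ?thesis
        using \<eta>(2) by simp
    qed
    then show "\<exists>X. negligible X \<and> (\<forall>n\<ge>1. norm ((\<Theta> n (S o\<^sub>L T) - (\<Theta> n S o\<^sub>L \<Theta> n T)) - X n) \<le> \<delta>)"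
      using mult_domainD[OF T S] by blast
  qed
  then show ?thesis
    using T_mem by (auto simp: mult_domain_def)
qed

end

section \<open>Convergence on the generated algebra\<close>

locale compressed_cp_maps = growth_class \<N> for \<N> :: "(nat \<Rightarrow> nat) set" +
  fixes P :: "nat \<Rightarrow> 'a::complex_hilbert_space operator"
    and \<Phi> :: "nat \<Rightarrow> 'a operator \<Rightarrow> 'a operator"
  assumes proj: "n \<ge> 1 \<Longrightarrow> orthogonal_projection (P n)"
    and rank: "n \<ge> 1 \<Longrightarrow> op_rank (P n) = n"
    and cp: "n \<ge> 1 \<Longrightarrow> completely_positive (\<Phi> n)"
    and contr: "n \<ge> 1 \<Longrightarrow> contractive (\<Phi> n)"
begin

abbreviation compressed_map :: "nat \<Rightarrow> 'a operator \<Rightarrow> 'a operator" where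
  "compressed_map n T \<equiv> P n o\<^sub>L \<Phi> n T o\<^sub>L P n"

abbreviation compression :: "nat \<Rightarrow> 'a operator \<Rightarrow> 'a operator" where
  "compression n T \<equiv> P n o\<^sub>L T o\<^sub>L P n"

lemma proj_adjoint: "n \<ge> 1 \<Longrightarrow> is_adjoint (P n) (P n)"
  using proj by (simp add: orthogonal_projection_def self_adjoint_def)

lemma proj_idem: "n \<ge> 1 \<Longrightarrow> P n o\<^sub>L P n = P n"
  using proj by (simp add: orthogonal_projection_def)

sublocale map: cp_contractions \<N> compressed_map
  by unfold_locales (simp_all add: completely_positive_compress contractive_compress cp contr proj_adjoint
      projection_norm_le proj)

sublocale comp: cp_contractions \<N> compression
  by unfold_locales (simp_all add: completely_positive_compress contractive_compress
      completely_positive_id contractive_id proj_adjoint projection_norm_le proj)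

text \<open>Agreement of the two sequences of maps passes to products where both are asymptotically multiplicative.
  The product rule also asks for an adjoint of the left factor, so the algebra consists of those operators that
  agree together with their adjoints.\<close>

definition agreeing :: "'a operator set" where
  "agreeing = {T \<in> map.mult_domain \<inter> comp.mult_domain. negligible (\<lambda>n. compressed_map n T - compression n T)}"

definition agreeing_algebra :: "'a operator set" where
  "agreeing_algebra = {T. \<exists>T'. is_adjoint T T' \<and> T \<in> agreeing \<and> T' \<in> agreeing}"

lemma agreeing_0: "0 \<in> agreeing"
proof -
  have "negligible (\<lambda>n. compressed_map n 0 - compression n 0)"
    by (rule negligible_cong[OF negligible_0])
      (simp add: linear_op_map_0[OF map.lin] linear_op_map_0[OF comp.lin])
  then show ?thesis
    by (simp add: agreeing_def map.mult_domain_0 comp.mult_domain_0)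
qed

lemma agreeing_add:
  assumes "S \<in> agreeing" "T \<in> agreeing"
  shows "S + T \<in> agreeing"
proof -
  have mem: "S \<in> bounded_ops" "T \<in> bounded_ops"
    using assms map.mult_domain_mem by (auto simp: agreeing_def)
  have "negligible (\<lambda>n. (compressed_map n S - compression n S) + (compressed_map n T - compression n T))"
    using assms by (intro negligible_add) (auto simp: agreeing_def)
  then have "negligible (\<lambda>n. compressed_map n (S + T) - compression n (S + T))"
    by (rule negligible_cong)
      (simp add: linear_op_map_add[OF map.lin] linear_op_map_add[OF comp.lin] mem)
  then show ?thesis
    using assms by (simp add: agreeing_def map.mult_domain_add comp.mult_domain_add)
qed

lemma agreeing_scaleC:
  assumes "T \<in> agreeing"
  shows "scaleC_op c T \<in> agreeing"
proof -
  have mem: "T \<in> bounded_ops"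
    using assms map.mult_domain_mem by (auto simp: agreeing_def)
  have "negligible (\<lambda>n. scaleC_op c (compressed_map n T - compression n T))"
    using assms by (intro negligible_scaleC) (auto simp: agreeing_def)
  then have "negligible (\<lambda>n. compressed_map n (scaleC_op c T) - compression n (scaleC_op c T))"
    by (rule negligible_cong)
      (simp add: linear_op_map_scaleC[OF map.lin] linear_op_map_scaleC[OF comp.lin] mem scaleC_op_diff)
  then show ?thesis
    using assms by (simp add: agreeing_def map.mult_domain_scaleC comp.mult_domain_scaleC)
qed

text \<open>With \<open>\<Psi>\<close> the compressed maps and \<open>C\<close> the compressions:
  \<open>\<Psi>(S T) \<approx> \<Psi>(S) \<Psi>(T) \<approx> C(S) \<Psi>(T) \<approx> C(S) C(T) \<approx> C(S T)\<close>.\<close>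

lemma agreeing_compose:
  assumes S: "S \<in> agreeing" and T: "T \<in> agreeing" and adj: "is_adjoint S S'"
  shows "S o\<^sub>L T \<in> agreeing"
proof -
  have mem: "S \<in> bounded_ops" "T \<in> bounded_ops"
    using S T map.mult_domain_mem by (auto simp: agreeing_def)
  have 1: "negligible (\<lambda>n. compressed_map n (S o\<^sub>L T) - (compressed_map n S o\<^sub>L compressed_map n T))"
    using map.mult_domainD[OF _ adj] T by (simp add: agreeing_def)
  have 2: "negligible (\<lambda>n. compression n (S o\<^sub>L T) - (compression n S o\<^sub>L compression n T))"
    using comp.mult_domainD[OF _ adj] T by (simp add: agreeing_def)
  have 3: "negligible (\<lambda>n. (compressed_map n S - compression n S) o\<^sub>L compressed_map n T)"
    using S contractiveD[OF map.contr mem(2)] linear_op_map_mem[OF map.lin mem(2)]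
    by (intro negligible_compose_right[where K = "norm T"]) (auto simp: agreeing_def)
  have 4: "negligible (\<lambda>n. compression n S o\<^sub>L (compressed_map n T - compression n T))"
    using T contractiveD[OF comp.contr mem(1)]
    by (intro negligible_compose_left[where K = "norm S"]) (auto simp: agreeing_def)
  have "negligible (\<lambda>n. compressed_map n (S o\<^sub>L T) - compression n (S o\<^sub>L T))"
    by (rule negligible_cong[OF negligible_add[OF negligible_diff[OF 1 2] negligible_add[OF 3 4]]])
      (simp only: compose_diff_left compose_diff_right, simp)
  then show ?thesis
    using S T map.mult_domain_compose[OF _ _ adj] comp.mult_domain_compose[OF _ _ adj] by (simp add: agreeing_def)
qed

lemma agreeing_limit:
  assumes X: "\<And>k. X k \<in> agreeing" and lim: "X \<longlonglongrightarrow> T" and T: "T \<in> bounded_ops"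
  shows "T \<in> agreeing"
proof -
  have "negligible (\<lambda>n. compressed_map n T - compression n T)"
  proof (rule negligible_limit)
    fix \<delta> :: real assume "\<delta> > 0"
    then obtain k where k: "norm (T - X k) < \<delta> / 2"
      using LIMSEQ_D[OF lim, of "\<delta> / 2"] by (metis half_gt_zero norm_minus_commute order_refl)
    have mem: "X k \<in> bounded_ops" "T - X k \<in> bounded_ops"
      using X[of k] map.mult_domain_mem T by (auto simp: agreeing_def bounded_ops_diff)
    have "norm ((compressed_map n T - compression n T) - (compressed_map n (X k) - compression n (X k))) \<le> \<delta>"
      if n: "n \<ge> 1" for n
    proof -
      have "(compressed_map n T - compression n T) - (compressed_map n (X k) - compression n (X k)) =
          compressed_map n (T - X k) - compression n (T - X k)"
        using linear_op_map_diff[OF map.lin[OF n] T mem(1)] linear_op_map_diff[OF comp.lin[OF n] T mem(1)] by simp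
      also have "norm \<dots> \<le> norm (compressed_map n (T - X k)) + norm (compression n (T - X k))"
        by (rule norm_triangle_ineq4)
      also have "\<dots> \<le> norm (T - X k) + norm (T - X k)"
        by (intro add_mono contractiveD[OF map.contr[OF n] mem(2)] contractiveD[OF comp.contr[OF n] mem(2)])
      finally show ?thesis
        using k by simp
    qed
    then show "\<exists>Z. negligible Z \<and> (\<forall>n\<ge>1. norm ((compressed_map n T - compression n T) - Z n) \<le> \<delta>)"
      using X[of k] by (auto simp: agreeing_def)
  qed
  then show ?thesis
    using X map.mult_domain_limit[OF _ lim T] comp.mult_domain_limit[OF _ lim T] by (auto simp: agreeing_def)
qed

lemma cstar_subalgebra_agreeing_algebra: "cstar_subalgebra agreeing_algebra"
  unfolding cstar_subalgebra_def
proof (intro conjI ballI allI impI)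
  show "agreeing_algebra \<subseteq> bounded_ops"
    by (auto simp: agreeing_algebra_def is_adjoint_def)
  show "0 \<in> agreeing_algebra"
    using is_adjoint_0 agreeing_0 by (auto simp: agreeing_algebra_def)
  show "closed agreeing_algebra"
    unfolding closed_sequential_limits
  proof (intro allI impI, elim conjE)
    fix X T assume X: "\<forall>k. X k \<in> agreeing_algebra" and lim: "X \<longlonglongrightarrow> T"
    have "\<forall>k. \<exists>Y. is_adjoint (X k) Y \<and> X k \<in> agreeing \<and> Y \<in> agreeing"
      using X by (auto simp: agreeing_algebra_def)
    then obtain Y where Y: "\<And>k. is_adjoint (X k) (Y k)" "\<And>k. X k \<in> agreeing" "\<And>k. Y k \<in> agreeing"
      by metis
    obtain S where S: "Y \<longlonglongrightarrow> S" "is_adjoint T S"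
      using is_adjoint_limit[OF Y(1) lim] by blast
    then show "T \<in> agreeing_algebra"
      using agreeing_limit[OF Y(2) lim] agreeing_limit[OF Y(3) S(1)]
      by (auto simp: agreeing_algebra_def is_adjoint_def)
  qed
next
  fix S T assume "S \<in> agreeing_algebra" "T \<in> agreeing_algebra"
  then obtain S' T' where adj: "is_adjoint S S'" "is_adjoint T T'"
    and mem: "S \<in> agreeing" "S' \<in> agreeing" "T \<in> agreeing" "T' \<in> agreeing"
    by (auto simp: agreeing_algebra_def)
  show "S + T \<in> agreeing_algebra"
    using is_adjoint_add[OF adj] mem agreeing_add by (auto simp: agreeing_algebra_def)
  show "S o\<^sub>L T \<in> agreeing_algebra"
    using is_adjoint_compose[OF adj] agreeing_compose[OF mem(1,3) adj(1)]
      agreeing_compose[OF mem(4,2) is_adjoint_sym[OF adj(2)]] by (auto simp: agreeing_algebra_def)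
next
  fix T c assume "T \<in> agreeing_algebra"
  then obtain T' where T': "is_adjoint T T'" "T \<in> agreeing" "T' \<in> agreeing"
    by (auto simp: agreeing_algebra_def)
  show "scaleC_op c T \<in> agreeing_algebra"
    using is_adjoint_scaleC[OF T'(1)] T' agreeing_scaleC by (auto simp: agreeing_algebra_def)
next
  fix T S assume "T \<in> agreeing_algebra" and S: "is_adjoint T S"
  then obtain T' where T': "is_adjoint T T'" "T \<in> agreeing" "T' \<in> agreeing"
    by (auto simp: agreeing_algebra_def)
  moreover have "T' = S"
    using is_adjoint_unique T'(1) S by blast
  ultimately show "S \<in> agreeing_algebra"
    using is_adjoint_sym by (auto simp: agreeing_algebra_def)
qed

definition converges :: "'a operator \<Rightarrow> bool" where
  "converges T \<longleftrightarrow> cluster (\<lambda>n. range_mat n (P n) (compressed_map n T)) (\<lambda>n. range_mat n (P n) (compression n T))"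

lemma converges_iff:
  assumes "T \<in> bounded_ops"
  shows "converges T \<longleftrightarrow> negligible (\<lambda>n. compressed_map n T - compression n T)"
  unfolding converges_def
proof (rule cluster_iff_negligible)
  fix n :: nat assume n: "n \<ge> 1"
  show "P n o\<^sub>L (compressed_map n T - compression n T) o\<^sub>L P n = compressed_map n T - compression n T"
    using proj_idem[OF n] by (simp add: compose_diff_left compose_diff_right op_compose_assoc)
      (simp flip: op_compose_assoc)
  show "compressed_map n T - compression n T \<in> bounded_ops"
    using linear_op_map_mem[OF map.lin[OF n] assms] linear_op_map_mem[OF comp.lin[OF n] assms]
    by (rule bounded_ops_diff)
qed (simp_all add: proj rank range_mat_diff)

lemma square_defect_iff:
  assumes "A \<in> bounded_ops"
  shows "cluster (\<lambda>n. range_mat n (P n) (square_defect (P n) A)) (\<lambda>n. 0\<^sub>m n n) \<longleftrightarrow>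
    negligible (\<lambda>n. compression n (A o\<^sub>L A) - (compression n A o\<^sub>L compression n A))"
  unfolding square_defect_def
proof (rule cluster_iff_negligible)
  fix n :: nat assume n: "n \<ge> 1"
  let ?D = "compression n (A o\<^sub>L A) - (compression n A o\<^sub>L compression n A)"
  show "P n o\<^sub>L ?D o\<^sub>L P n = ?D"
    using proj_idem[OF n] by (simp add: compose_diff_left compose_diff_right op_compose_assoc)
      (simp flip: op_compose_assoc)
  show "?D \<in> bounded_ops"
    using linear_op_map_mem[OF comp.lin[OF n]] assms by (simp add: bounded_ops_diff bounded_ops_compose)
  show "range_mat n (P n) ?D - 0\<^sub>m n n = range_mat n (P n) ?D"
    using range_mat_dim[of n "P n" ?D] by (intro eq_matI) auto
qed (simp_all add: proj rank)

text \<open>The square defect is the Schwarz defect of \<open>A\<close> for the compressions. Convergence at \<open>A\<close> and at \<open>A\<^sup>2\<close>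
  carries it over to the compressed maps:
  \<open>\<Psi>(A\<^sup>2) \<approx> C(A\<^sup>2) \<approx> C(A)\<^sup>2 \<approx> C(A) \<Psi>(A) \<approx> \<Psi>(A)\<^sup>2\<close>.\<close>

lemma agreeing_self_adjoint:
  assumes A: "self_adjoint A" and conv: "converges A" "converges (A o\<^sub>L A)"
    and defect: "cluster (\<lambda>n. range_mat n (P n) (square_defect (P n) A)) (\<lambda>n. 0\<^sub>m n n)"
  shows "A \<in> agreeing"
proof -
  have mem: "A \<in> bounded_ops" "A o\<^sub>L A \<in> bounded_ops"
    using A by (auto simp: self_adjoint_def is_adjoint_def bounded_ops_compose)
  have 1: "negligible (\<lambda>n. compressed_map n A - compression n A)"
    and 2: "negligible (\<lambda>n. compressed_map n (A o\<^sub>L A) - compression n (A o\<^sub>L A))"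
    using conv mem by (simp_all add: converges_iff)
  have 3: "negligible (\<lambda>n. compression n (A o\<^sub>L A) - (compression n A o\<^sub>L compression n A))"
    using defect mem(1) by (simp add: square_defect_iff)
  have 4: "negligible (\<lambda>n. (compressed_map n A - compression n A) o\<^sub>L compressed_map n A)"
    using contractiveD[OF map.contr mem(1)] linear_op_map_mem[OF map.lin mem(1)]
    by (intro negligible_compose_right[OF 1, where K = "norm A"]) auto
  have 5: "negligible (\<lambda>n. compression n A o\<^sub>L (compressed_map n A - compression n A))"
    using contractiveD[OF comp.contr mem(1)]
    by (intro negligible_compose_left[OF 1, where K = "norm A"]) auto
  have "negligible (\<lambda>n. compressed_map n (A o\<^sub>L A) - (compressed_map n A o\<^sub>L compressed_map n A))"
    by (rule negligible_cong[OF negligible_diff[OF negligible_add[OF 2 3] negligible_add[OF 4 5]]])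
      (simp only: compose_diff_left compose_diff_right, simp)
  then have "A \<in> map.mult_domain"
    by (rule map.mult_domain_square[OF A])
  moreover have "A \<in> comp.mult_domain"
    by (rule comp.mult_domain_square[OF A 3])
  ultimately show ?thesis
    using 1 by (simp add: agreeing_def)
qed

theorem converges_on_generated_algebra:
  assumes G: "\<And>A. A \<in> G \<Longrightarrow> self_adjoint A" "\<And>A. A \<in> G \<Longrightarrow> converges A" "\<And>A. A \<in> G \<Longrightarrow> converges (A o\<^sub>L A)"
    and defect: "\<And>A. A \<in> G \<Longrightarrow> cluster (\<lambda>n. range_mat n (P n) (square_defect (P n) A)) (\<lambda>n. 0\<^sub>m n n)"
    and T: "T \<in> cstar_generated G"
  shows "converges T"
proof -
  have "G \<subseteq> agreeing_algebra"
    using agreeing_self_adjoint G defect self_adjointD by (fastforce simp: agreeing_algebra_def)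
  then have "T \<in> agreeing_algebra"
    using T cstar_subalgebra_agreeing_algebra by (auto simp: cstar_generated_def)
  then show ?thesis
    using converges_iff by (auto simp: agreeing_algebra_def agreeing_def is_adjoint_def)
qed

end

definition bounded_growth :: "(nat \<Rightarrow> nat) set" where
  "bounded_growth = range (\<lambda>N n. N)"

definition sublinear_growth :: "(nat \<Rightarrow> nat) set" where
  "sublinear_growth = {N. (\<lambda>n. real (N n)) \<in> o(\<lambda>n. real n)}"

interpretation strong: growth_class bounded_growth
  by unfold_locales (auto simp: bounded_growth_def)

interpretation weak: growth_class sublinear_growth
  by unfold_locales (auto simp: sublinear_growth_def sum_in_smallo)

lemma eventually_greater_iff:
  fixes Q :: "nat \<Rightarrow> bool"
  shows "(\<exists>m. \<forall>n>m. Q n) \<longleftrightarrow> eventually Q sequentially"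
  by (rule eventually_at_top_dense[symmetric])

lemma strong_cluster_iff: "strong_cluster X Y \<longleftrightarrow> strong.cluster X Y"
  unfolding strong_cluster_def strong.cluster_def eventually_greater_iff by (simp add: bounded_growth_def)

lemma weak_cluster_iff: "weak_cluster X Y \<longleftrightarrow> weak.cluster X Y"
  unfolding weak_cluster_def weak.cluster_def eventually_greater_iff[symmetric]
  by (simp add: sublinear_growth_def)

theorem theorem3p4:
  fixes P :: "nat \<Rightarrow> 'a::complex_hilbert_space operator"
    and \<Phi> :: "nat \<Rightarrow> 'a operator \<Rightarrow> 'a operator"
    and A :: "nat \<Rightarrow> 'a operator"
    and m :: nat
  assumes separable: "separable_space (euclidean :: 'a topology)"
    and proj: "\<And>n. n \<ge> 1 \<Longrightarrow> orthogonal_projection (P n)"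
    and rank: "\<And>n. n \<ge> 1 \<Longrightarrow> op_rank (P n) = n"
    and proj_tendsto: "\<And>x. (\<lambda>n. P n x) \<longlonglongrightarrow> x"
    and cp: "\<And>n. n \<ge> 1 \<Longrightarrow> completely_positive (\<Phi> n)"
    and contr: "\<And>n. n \<ge> 1 \<Longrightarrow> contractive (\<Phi> n)"
    and sa: "\<And>k. k \<in> {1..m} \<Longrightarrow> self_adjoint (A k)"
  shows
    "((\<forall>k\<in>{1..m}. strong_distribution_conv P \<Phi> (A k) \<and>
                  strong_distribution_conv P \<Phi> (A k o\<^sub>L A k) \<and>
                  strong_cluster (\<lambda>n. range_mat n (P n) (square_defect (P n) (A k)))
                                 (\<lambda>n. 0\<^sub>m n n))
        \<longrightarrow> (\<forall>T \<in> cstar_generated (A ` {1..m}). strong_distribution_conv P \<Phi> T))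
     \<and>
     ((\<forall>k\<in>{1..m}. weak_distribution_conv P \<Phi> (A k) \<and>
                  weak_distribution_conv P \<Phi> (A k o\<^sub>L A k) \<and>
                  weak_cluster (\<lambda>n. range_mat n (P n) (square_defect (P n) (A k)))
                               (\<lambda>n. 0\<^sub>m n n))
        \<longrightarrow> (\<forall>T \<in> cstar_generated (A ` {1..m}). weak_distribution_conv P \<Phi> T))"
proof -
  interpret s: compressed_cp_maps bounded_growth P \<Phi>
    by unfold_locales (auto intro: proj rank cp contr)
  interpret w: compressed_cp_maps sublinear_growth P \<Phi>
    by unfold_locales (auto intro: proj rank cp contr)
  have strong: "strong_distribution_conv P \<Phi> = s.converges"
    by (simp add: fun_eq_iff strong_distribution_conv_def s.converges_def strong_cluster_iff)
  have weak: "weak_distribution_conv P \<Phi> = w.converges"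
    by (simp add: fun_eq_iff weak_distribution_conv_def w.converges_def weak_cluster_iff)
  show ?thesis
    unfolding strong weak strong_cluster_iff weak_cluster_iff
  proof (intro conjI impI ballI)
    fix T assume "T \<in> cstar_generated (A ` {1..m})"
    then show "s.converges T" if "\<forall>k\<in>{1..m}. s.converges (A k) \<and> s.converges (A k o\<^sub>L A k) \<and>
        strong.cluster (\<lambda>n. range_mat n (P n) (square_defect (P n) (A k))) (\<lambda>n. 0\<^sub>m n n)"
      by (rule s.converges_on_generated_algebra[rotated -1]) (use that sa in blast)+
    show "w.converges T" if "\<forall>k\<in>{1..m}. w.converges (A k) \<and> w.converges (A k o\<^sub>L A k) \<and>
        weak.cluster (\<lambda>n. range_mat n (P n) (square_defect (P n) (A k))) (\<lambda>n. 0\<^sub>m n n)"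
      using \<open>T \<in> cstar_generated (A ` {1..m})\<close>
      by (rule w.converges_on_generated_algebra[rotated -1]) (use that sa in blast)+
  qed
qed

end
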